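(* Let $n \ge 2$, $m \ge 0$ be integers and $p$ a prime with $\gcd(n,p)=1$. Let $G = (C_n \times C_{p^m}) \rtimes_\alpha C_p$ be an $SMC(n,m,p)$ in which $C_p$ acts trivially on $C_{p^m}$. 1) If $p$ is odd and $m=0$, then $$\mathrm{Spec}_R(G) = \left\{ p + \frac{\Sigma(d)}{p} - 1 \;\middle|\; d \in D(n,p)\right\}.$$ 2) If $p$ is odd and $m \ge 1$, then $$\mathrm{Spec}_R(G) = \left\{ p^{e+1} + p^{e-1}(\Sigma(d)-p) \;\middle|\; 0 \le e \le m,\ d \in D(n,p)\right\} \cup \left\{ p^{m} + p^{m-1}(\Sigma(d)-p) \;\middle|\; d \in D(n,p)\right\}.$$ 3) If $p=2$, $m=0$ and $n \not\equiv 0 \bmod 3$, then $$\mathrm{Spec}_R(G) = \left\{ 2 + \frac{\Sigma(d)}{2} - 1 \;\middle|\; d \in D(n,2)\right\}.$$ 4) If $p=2$, $m\ge 1$ and $n \not\equiv 0 \bmod 3$, then $$\mathrm{Spec}_R(G) = \left\{ 2^{e+1} + 2^{e-1}(\Sigma(d)-2) \;\middle|\; 1 \le e \le m,\ d \in D(n,2)\right\} \cup \left\{ 2^{m} + 2^{m-1}(\Sigma(d)-2) \;\middle|\; d \in D(n,2)\right\}.$$ 5) If $p=2$ and $n \equiv 0 \bmod 3$, then $\mathrm{Spec}_R(G)$ is given by the formula of 3) when $m=0$, and by the formula of 4) when $m\ge 1$, with $D(n,2)$ replaced by $D'(n,2)$ throughout.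
   Context: For a group $G$ and $\varphi \in \mathrm{Aut}(G)$, elements $g_1,g_2\in G$ are $\varphi$-conjugate if $g_1 = g g_2 \varphi(g)^{-1}$ for some $g\in G$; the Reidemeister number $R(\varphi)$ is the number of equivalence classes of this relation, and $\mathrm{Spec}_R(G) = \{R(\varphi) \mid \varphi\in \mathrm{Aut}(G)\}$. $C_k$ denotes the cyclic group of order $k$. An $SMC(n,m,p)$ is any semidirect product $(C_n\times C_{p^m})\rtimes_\alpha C_p$ (with $n\ge1$, $m\ge 0$, $p$ prime, $\gcd(n,p)=1$, $\alpha: C_p \to \mathrm{Aut}(C_n\times C_{p^m})$ a homomorphism) where $C_p$ acts freely by automorphisms on $C_n$, i.e. the only element of $C_n$ fixed by all of $C_p$ is the identity. For positive integers $a,b$: $D(a,b)$ is the set of tuples $(d_1,\dots,d_b)\in \mathbb{Z}_{\ge 0}^b$ such that each $d_i$ divides $a$ and $\gcd(d_i,d_j)=1$ for all $i\ne j$; $D'(a,b)$ is the set of $(d_1,\dots,d_b)\in D(a,b)$ such that $d_i\equiv 0 \bmod 3$ for some $i$. For $d=(d_1,\dots,d_b)$, $\Sigma(d) = \sum_{i=1}^{b} d_i$ (here $b=p$). *)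

theory Defs
  imports
    "HOL-Algebra.Bij"
    "HOL-Algebra.Elementary_Groups"
    "HOL-Computational_Algebra.Primes"
    "HOL-Library.Extended_Real"
begin

definition twisted_conj :: "('a, 'b) monoid_scheme \<Rightarrow> ('a \<Rightarrow> 'a) \<Rightarrow> ('a \<times> 'a) set" where
  "twisted_conj G \<phi> = {(g1, g2). g1 \<in> carrier G \<and> g2 \<in> carrier G \<and>
     (\<exists>g\<in>carrier G. g1 = g \<otimes>\<^bsub>G\<^esub> g2 \<otimes>\<^bsub>G\<^esub> inv\<^bsub>G\<^esub> (\<phi> g))}"

definition reidemeister_number :: "('a, 'b) monoid_scheme \<Rightarrow> ('a \<Rightarrow> 'a) \<Rightarrow> enat" where
  "reidemeister_number G \<phi> =
     (if finite (carrier G // twisted_conj G \<phi>)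
      then enat (card (carrier G // twisted_conj G \<phi>)) else \<infinity>)"

definition reidemeister_spectrum :: "('a, 'b) monoid_scheme \<Rightarrow> enat set" where
  "reidemeister_spectrum G = {reidemeister_number G \<phi> | \<phi>. \<phi> \<in> auto G}"

definition semidirect_product ::
    "('a, 'c) monoid_scheme \<Rightarrow> ('b, 'd) monoid_scheme \<Rightarrow> ('b \<Rightarrow> 'a \<Rightarrow> 'a) \<Rightarrow> ('a \<times> 'b) monoid" where
  "semidirect_product N H \<alpha> =
     \<lparr>carrier = carrier N \<times> carrier H,
      monoid.mult = (\<lambda>(x, h) (y, k). (x \<otimes>\<^bsub>N\<^esub> \<alpha> h y, h \<otimes>\<^bsub>H\<^esub> k)),
      one = (\<one>\<^bsub>N\<^esub>, \<one>\<^bsub>H\<^esub>)\<rparr>"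

abbreviation SMC_base :: "nat \<Rightarrow> nat \<Rightarrow> nat \<Rightarrow> (int \<times> int) monoid" where
  "SMC_base n m p \<equiv> integer_mod_group n \<times>\<times> integer_mod_group (p ^ m)"

text \<open>
  The factors are additive copies of the integers modulo \<open>n\<close>, \<open>p ^ m\<close> and \<open>p\<close>, so
  \<open>0\<close> is their identity. The factor of order \<open>n\<close> consists of the pairs \<open>(x, 0)\<close>. It is
  characteristic because \<open>n\<close> and \<open>p\<close> are coprime, so every \<open>\<alpha> c\<close> preserves it.
\<close>

definition SMC_action :: "nat \<Rightarrow> nat \<Rightarrow> nat \<Rightarrow> (int \<Rightarrow> int \<times> int \<Rightarrow> int \<times> int) \<Rightarrow> bool" where
  "SMC_action n m p \<alpha> \<longleftrightarrow>
     n \<ge> 1 \<and> prime p \<and> gcd n p = 1 \<and>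
     \<alpha> \<in> hom (integer_mod_group p) (AutoGroup (SMC_base n m p)) \<and>
     (\<forall>x\<in>carrier (integer_mod_group n).
        (\<forall>c\<in>carrier (integer_mod_group p). \<alpha> c (x, 0) = (x, 0)) \<longrightarrow> x = 0)"

definition SMC_group ::
    "nat \<Rightarrow> nat \<Rightarrow> nat \<Rightarrow> (int \<Rightarrow> int \<times> int \<Rightarrow> int \<times> int) \<Rightarrow> ((int \<times> int) \<times> int) monoid" where
  "SMC_group n m p \<alpha> = semidirect_product (SMC_base n m p) (integer_mod_group p) \<alpha>"

text \<open>Tuples are lists, with entries indexed from \<open>0\<close>.\<close>

definition coprime_divisor_tuples :: "nat \<Rightarrow> nat \<Rightarrow> nat list set" where
  "coprime_divisor_tuples a b =
     {d. length d = b \<and> (\<forall>i<b. d ! i dvd a) \<and>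
         (\<forall>i<b. \<forall>j<b. i \<noteq> j \<longrightarrow> gcd (d ! i) (d ! j) = 1)}"

definition coprime_divisor_tuples3 :: "nat \<Rightarrow> nat \<Rightarrow> nat list set" where
  "coprime_divisor_tuples3 a b =
     {d \<in> coprime_divisor_tuples a b. \<exists>i<b. d ! i mod 3 = 0}"

end

theory Submission
  imports Defs "HOL-Number_Theory.Residues"
begin

text \<open>
  Write \<open>\<omega>\<close> for the multiplier by which the generator of \<open>C\<^sub>p\<close> acts on \<open>C\<^sub>n\<close>. It satisfies \<open>\<omega> ^ p = 1\<close>
  modulo \<open>n\<close>, and freeness makes \<open>\<omega> - 1\<close>, hence \<open>\<omega> ^ k - 1\<close> for every \<open>k\<close> not divisible by \<open>p\<close>, invertible
  modulo \<open>n\<close>. With \<open>s\<^sub>c = 1 + \<omega> + \<dots> + \<omega> ^ (c - 1)\<close>, every automorphism has the form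
  \<open>(x, z, c) \<mapsto> (u x + a s\<^sub>c, v z + b c, c)\<close> with units \<open>u\<close> and \<open>v\<close>, with \<open>a\<close> arbitrary and with \<open>p b = 0\<close>
  modulo \<open>p ^ m\<close> (lemma \<open>automorphism_form\<close>), because it preserves \<open>C\<^sub>n\<close>, the centre \<open>C\<^bsub>p^m\<^esub>\<close>, and the
  action on \<open>C\<^sub>n\<close>.

  Twisted conjugation preserves \<open>c\<close>. Dividing out the part of it that comes from \<open>C\<^sub>n\<close> and \<open>C\<^bsub>p^m\<^esub>\<close> reduces
  the coset \<open>c\<close> to \<open>C\<^bsub>d\<^esub> \<times> C\<^bsub>p^e\<^esub>\<close>, where \<open>d = d\<^sub>c = gcd (1 - \<omega> ^ c u, n)\<close> and \<open>p ^ e = gcd (1 - v, p ^ m)\<close>. The remaining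
  action of \<open>C\<^sub>p\<close> is affine on the first factor, with a fixed point that can be moved to \<open>0\<close>, and is
  the translation by \<open>- b\<close> on the second factor. If \<open>p ^ e\<close> divides \<open>b\<close>, the coset has \<open>p ^ e\<close> fixed points
  and otherwise orbits of length \<open>p\<close>, which gives \<open>p ^ e (1 + (d\<^sub>c - 1) / p)\<close> classes. If not, then
  \<open>e = m \<ge> 1\<close> and all orbits have length \<open>p\<close>, which gives \<open>p ^ (m - 1) d\<^sub>c\<close> classes. Summation over \<open>c\<close>
  yields the two families of values (lemma \<open>reidemeister_number_cases\<close>).

  It remains to determine which tuples \<open>(d\<^sub>c)\<close> occur (lemma \<open>fix_counts_range\<close>). Their entries are pairwise coprime
  divisors of \<open>n\<close>, since a common divisor would make two powers of \<open>\<omega>\<close> congruent. Conversely a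
  tuple can be prescribed one prime \<open>q\<close> of \<open>n\<close> at a time by the Chinese remainder theorem. When \<open>q\<close> divides no
  entry, a unit modulo \<open>q\<close> outside the \<open>p\<close> powers of \<open>\<omega>\<close> is needed; since \<open>p\<close> divides \<open>q - 1\<close>, it
  exists unless \<open>q = p + 1\<close>, that is, \<open>p = 2\<close> and \<open>q = 3\<close>. In that case some entry is necessarily divisible by \<open>3\<close>.
\<close>

section \<open>Fixed-point-free units and coprime divisor tuples\<close>

text \<open>
  Modulo a common divisor \<open>g\<close> of \<open>w ^ t - 1\<close> and \<open>N\<close>, the order of \<open>w\<close> divides the coprime
  numbers \<open>t\<close> and \<open>p\<close>, so \<open>w\<close> is \<open>1\<close> modulo \<open>g\<close>. Thus a unit of order dividing a prime whose
  first power acts without nonzero fixed points has all its nontrivial powers acting that way.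
\<close>

lemma coprime_pow_minus_one_of_coprime_exponent:
  fixes w N :: int
  assumes wp: "[w ^ p = 1] (mod N)" and w1: "coprime (w - 1) N" and tp: "coprime t p"
  shows "coprime (w ^ t - 1) N"
proof (rule coprimeI)
  fix g assume g: "g dvd w ^ t - 1" "g dvd N"
  have gt: "[w ^ t = 1] (mod g)" using g(1) by (simp add: cong_iff_dvd_diff)
  have gp: "[w ^ p = 1] (mod g)" using wp g(2) by (rule cong_dvd_modulus)
  have "[w = 1] (mod g)"
  proof (cases "t = 0")
    case True
    then show ?thesis using tp gp by simp
  next
    case False
    obtain x y where xy: "t * x = p * y + 1"
      using bezout_nat[OF False, of p] tp by auto
    have "[w ^ (t * x) = 1] (mod g)" using cong_pow[OF gt, of x] by (simp add: power_mult)
    moreover have "[w ^ (p * y + 1) = w] (mod g)"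
      using cong_scalar_left[OF cong_pow[OF gp, of y], of w] by (simp add: power_mult)
    ultimately show ?thesis unfolding xy by (metis cong_sym cong_trans)
  qed
  then have "g dvd w - 1" by (simp add: cong_iff_dvd_diff)
  then show "is_unit g" using w1 g(2) by (simp add: coprime_def)
qed

text \<open>
  Passes from the local conditions delivered by the Chinese remainder theorem back to the modulus \<open>n\<close>.
\<close>

lemma gcd_eq_if_prime_power_gcd_eq:
  fixes s t n :: nat
  assumes n: "n > 0"
    and eq: "\<And>q. prime q \<Longrightarrow> q dvd n \<Longrightarrow>
               gcd s (q ^ multiplicity q n) = gcd t (q ^ multiplicity q n)"
  shows "gcd s n = gcd t n"
proof -
  have dvd: "gcd a n dvd gcd b n"
    if h: "\<And>q. prime q \<Longrightarrow> q dvd n \<Longrightarrow>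
             gcd a (q ^ multiplicity q n) = gcd b (q ^ multiplicity q n)" for a b
  proof (rule multiplicity_le_imp_dvd)
    show "gcd a n \<noteq> 0" using n by simp
    fix q :: nat assume q: "prime q"
    let ?j = "multiplicity q (gcd a n)"
    have "q ^ ?j dvd gcd a n" by (rule multiplicity_dvd)
    then have ja: "q ^ ?j dvd a" and jn: "q ^ ?j dvd n" by auto
    have "q ^ ?j dvd b"
    proof (cases "q dvd n")
      case True
      have "?j \<le> multiplicity q n"
        using jn n q by (metis multiplicity_geI not_prime_unit neq0_conv)
      then have "q ^ ?j dvd gcd a (q ^ multiplicity q n)"
        using ja by (simp add: le_imp_power_dvd)
      then show ?thesis using h[OF q True] by simp
    next
      case False
      then have "?j = 0" by (meson dvd_trans gcd_dvd2 not_dvd_imp_multiplicity_0)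
      then show ?thesis by simp
    qed
    with jn have "q ^ ?j dvd gcd b n" by simp
    then show "?j \<le> multiplicity q (gcd b n)"
      using n q by (metis gcd_eq_0_iff multiplicity_geI not_prime_unit neq0_conv)
  qed
  show ?thesis by (rule dvd_antisym) (rule dvd, simp add: eq)+
qed

lemma coprime_if_mult_inj_mod:
  fixes u N :: int
  assumes "N > 0" and inj: "\<And>x. N dvd u * x \<Longrightarrow> N dvd x"
  shows "coprime u N"
proof -
  obtain g u' N' where g: "g = gcd u N" and u': "u = g * u'" and N': "N = g * N'"
    by (metis dvdE gcd_dvd1 gcd_dvd2)
  have "u * N' = N * u'" unfolding u' N' by simp
  then have "N dvd N'" using inj[of N'] by simp
  then have "g * N' dvd 1 * N'" using N' by simp
  moreover have "N' \<noteq> 0" using N' assms(1) by auto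
  ultimately have "g dvd 1" by (simp only: dvd_mult_cancel_right) simp
  then show ?thesis by (simp add: g coprime_iff_gcd_eq_1)
qed

text \<open>
  The locale describes the action of \<open>C\<^sub>p\<close> on \<open>C\<^sub>n\<close> arithmetically: a generator multiplies by \<open>\<omega>\<close>, and
  coprimality of \<open>\<omega> - 1\<close> and \<open>n\<close> says that \<open>0\<close> is its only fixed point.
\<close>

locale fixed_point_free_unit =
  fixes n p :: nat and \<omega> :: int
  assumes n_ge_2: "n \<ge> 2" and prime_p: "prime p"
    and omega_power_p: "[\<omega> ^ p = 1] (mod int n)"
    and coprime_omega_minus_one: "coprime (\<omega> - 1) (int n)"
begin

lemma p_pos: "p > 0" using prime_p prime_gt_0_nat by blast
lemma p_ge_2: "p \<ge> 2" using prime_p prime_ge_2_nat by blast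

lemma coprime_omega_power_minus_one:
  assumes "\<not> p dvd t"
  shows "coprime (\<omega> ^ t - 1) (int n)"
  using coprime_pow_minus_one_of_coprime_exponent[OF omega_power_p coprime_omega_minus_one]
    prime_imp_coprime[OF prime_p assms] by (simp add: coprime_commute)

lemma coprime_omega: "coprime \<omega> (int n)"
proof -
  have "coprime (\<omega> ^ p) (int n)"
    using cong_imp_coprime[OF cong_sym[OF omega_power_p]] by simp
  then show ?thesis using p_pos by simp
qed

lemma omega_power_mult_p: "[\<omega> ^ (p * k) = 1] (mod int n)"
  using cong_pow[OF omega_power_p, of k] by (simp add: power_mult)

lemma omega_power_mod: "[\<omega> ^ (k mod p) = \<omega> ^ k] (mod int n)"
proof -
  have "\<omega> ^ k = \<omega> ^ (p * (k div p)) * \<omega> ^ (k mod p)"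
    by (simp flip: power_add)
  moreover have "[\<omega> ^ (p * (k div p)) * \<omega> ^ (k mod p) = 1 * \<omega> ^ (k mod p)] (mod int n)"
    by (rule cong_scalar_right[OF omega_power_mult_p])
  ultimately show ?thesis by (simp add: cong_sym_eq)
qed

lemma omega_power_cong: "[i = j] (mod p) \<Longrightarrow> [\<omega> ^ i = \<omega> ^ j] (mod int n)"
  by (metis cong_def omega_power_mod)

lemma cong_power_imp_unit:
  assumes "g dvd int n" "[\<omega> ^ i * x = \<omega> ^ j * x] (mod g)" "coprime x g" "i mod p \<noteq> j mod p"
  shows "is_unit g"
proof -
  have *: "is_unit g" if "i < j" "i mod p \<noteq> j mod p" "[\<omega> ^ i = \<omega> ^ j] (mod g)" for i j
  proof -
    have "\<omega> ^ j - \<omega> ^ i = \<omega> ^ i * (\<omega> ^ (j - i) - 1)"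
      using \<open>i < j\<close> by (simp add: right_diff_distrib flip: power_add)
    then have "g dvd \<omega> ^ i * (\<omega> ^ (j - i) - 1)"
      using that(3) by (metis cong_iff_dvd_diff cong_sym_eq)
    moreover have "coprime g (\<omega> ^ i)"
      using coprime_omega assms(1) by (metis coprime_commute coprime_divisors coprime_power_left_iff dvd_refl)
    ultimately have "g dvd \<omega> ^ (j - i) - 1" by (simp add: coprime_dvd_mult_right_iff)
    moreover have "\<not> p dvd j - i" using that by (metis mod_eq_dvd_iff_nat less_imp_le)
    ultimately show ?thesis
      using coprime_omega_power_minus_one assms(1) coprime_common_divisor by blast
  qed
  have "[\<omega> ^ i = \<omega> ^ j] (mod g)" using assms(2,3) by (simp add: cong_mult_rcancel)
  moreover have "i \<noteq> j" using assms(4) by auto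
  ultimately show ?thesis using *[of i j] *[of j i] assms(4) by (metis cong_sym linorder_neqE_nat)
qed

text \<open>
  Modulo a prime divisor \<open>q\<close> of \<open>n\<close> the unit \<open>\<omega>\<close> has order exactly \<open>p\<close>, so Fermat's theorem applies.
\<close>

lemma dvd_prime_divisor_minus_one:
  assumes q: "prime q" "q dvd n"
  shows "p dvd q - 1"
proof (rule ccontr)
  assume "\<not> p dvd q - 1"
  then have "coprime (\<omega> ^ (q - 1) - 1) (int n)" by (rule coprime_omega_power_minus_one)
  moreover have "[\<omega> ^ (q - 1) = 1] (mod int q)"
  proof -
    let ?a = "nat (\<omega> mod int q)"
    have cw: "coprime \<omega> (int q)" using coprime_omega q(2) by (meson coprime_divisors dvd_refl int_dvd_int_iff)
    have a: "[int ?a = \<omega>] (mod int q)" using q(1) prime_gt_0_nat by simp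
    have "coprime (int ?a) (int q)" using a cw cong_imp_coprime cong_sym by blast
    then have "coprime ?a q" by (simp only: coprime_int_iff)
    then have "[?a ^ totient q = 1] (mod q)" by (rule euler_theorem)
    then have "[?a ^ (q - 1) = 1] (mod q)" using q(1) by (simp add: totient_prime)
    then have "[int ?a ^ (q - 1) = 1] (mod int q)" by (metis cong_int_iff of_nat_1 of_nat_power)
    then show ?thesis using cong_pow[OF a, of "q - 1"] by (metis cong_sym cong_trans)
  qed
  then have "int q dvd \<omega> ^ (q - 1) - 1" by (simp add: cong_iff_dvd_diff)
  ultimately have "is_unit (int q)" using q(2) coprime_common_divisor by fastforce
  then show False using q(1) by simp
qed

text \<open>
  The number of fixed points on \<open>C\<^sub>n\<close> of multiplication by \<open>\<omega> ^ c * u\<close>, which is also the index of the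
  subgroup of multiples of \<open>1 - \<omega> ^ c * u\<close>.
\<close>

definition fix_count :: "int \<Rightarrow> nat \<Rightarrow> nat" where
  "fix_count u c = nat (gcd (1 - \<omega> ^ c * u) (int n))"

lemma int_fix_count: "int (fix_count u c) = gcd (1 - \<omega> ^ c * u) (int n)"
  by (simp add: fix_count_def)

lemma fix_count_pos: "fix_count u c > 0"
  using n_ge_2 by (simp add: fix_count_def)

lemma fix_count_dvd: "fix_count u c dvd n"
  using int_fix_count[of u c] by (metis gcd_dvd2 int_dvd_int_iff)

text \<open>
  A common divisor of two entries would make two distinct powers of \<open>\<omega>\<close> congruent, both being inverse
  to \<open>u\<close>.
\<close>

lemma fix_count_coprime:
  assumes "i < p" "j < p" "i \<noteq> j"
  shows "coprime (fix_count u i) (fix_count u j)"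
proof -
  let ?g = "gcd (int (fix_count u i)) (int (fix_count u j))"
  have gi: "?g dvd 1 - \<omega> ^ i * u" and gj: "?g dvd 1 - \<omega> ^ j * u" and gn: "?g dvd int n"
    using int_fix_count by (metis dvd_trans gcd_dvd1 gcd_dvd2)+
  have "?g dvd (1 - \<omega> ^ j * u) - (1 - \<omega> ^ i * u)" using gi gj by (rule dvd_diff[rotated])
  then have "[\<omega> ^ i * u = \<omega> ^ j * u] (mod ?g)" by (simp add: cong_iff_dvd_diff)
  moreover have "coprime u ?g"
  proof (rule coprimeI)
    fix h assume "h dvd u" "h dvd ?g"
    then have "h dvd 1 - \<omega> ^ i * u" "h dvd \<omega> ^ i * u" using gi by (auto intro: dvd_trans)
    then show "is_unit h" by (metis add.commute diff_add_cancel dvd_add)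
  qed
  ultimately have "is_unit ?g" using cong_power_imp_unit[OF gn] assms by simp
  then show ?thesis by (simp add: coprime_iff_gcd_eq_1)
qed

definition fix_counts :: "int \<Rightarrow> nat list" where
  "fix_counts u = map (fix_count u) [0..<p]"

lemma fix_counts_in_coprime_divisor_tuples: "fix_counts u \<in> coprime_divisor_tuples n p"
  using fix_count_dvd fix_count_coprime
  by (auto simp: coprime_divisor_tuples_def fix_counts_def)

lemma sum_list_fix_counts: "sum_list (fix_counts u) = (\<Sum>c<p. fix_count u c)"
  by (simp add: fix_counts_def interv_sum_list_conv_sum_set_nat atLeast0LessThan)

text \<open>
  The source of the exceptional case: for \<open>p = 2\<close> the unit \<open>\<omega>\<close> is \<open>-1\<close> modulo \<open>3\<close>, so \<open>u\<close> and \<open>\<omega> * u\<close>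
  exhaust the two units modulo \<open>3\<close> and one of them is \<open>1\<close>.
\<close>

lemma three_dvd_fix_count:
  assumes "p = 2" "n mod 3 = 0" "coprime u (int n)"
  shows "\<exists>i<p. 3 dvd fix_count u i"
proof -
  have n3: "(3::int) dvd int n" using assms(2) by presburger
  have "\<not> 3 dvd u" using assms(3) n3 coprime_common_divisor[of u "int n" 3] by auto
  have "\<not> 3 dvd \<omega> - 1" using coprime_omega_minus_one n3 coprime_common_divisor[of "\<omega> - 1" "int n" 3] by auto
  moreover have "\<not> 3 dvd \<omega>" using coprime_omega n3 coprime_common_divisor[of \<omega> "int n" 3] by auto
  ultimately have w: "3 dvd \<omega> + 1" by presburger
  have "3 dvd 1 - u \<or> 3 dvd 1 + u" using \<open>\<not> 3 dvd u\<close> by presburger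
  then have "3 dvd 1 - \<omega> ^ 0 * u \<or> 3 dvd 1 - \<omega> ^ 1 * u"
  proof
    assume "3 dvd 1 + u"
    then have "3 dvd (1 + u) - (\<omega> + 1) * u" using w by (intro dvd_diff dvd_mult2)
    then show ?thesis by (simp add: algebra_simps)
  qed simp
  then obtain i where i: "i < 2" "3 dvd 1 - \<omega> ^ i * u" by (metis one_less_numeral_iff pos2 semiring_norm(76))
  then have "(3::int) dvd int (fix_count u i)" using n3 by (simp add: int_fix_count)
  then have "3 dvd fix_count u i" by presburger
  then show ?thesis using i assms(1) by blast
qed

text \<open>
  A prime divisor \<open>q\<close> of no entry of the tuple requires a unit modulo \<open>q\<close> that is not inverse to any
  power of \<open>\<omega>\<close>. There are \<open>q - 1\<close> units and at most \<open>p\<close> powers, and \<open>p\<close> divides \<open>q - 1\<close>; equality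
  \<open>q = p + 1\<close> of primes occurs only for \<open>2\<close> and \<open>3\<close>.
\<close>

lemma exists_residue_avoiding_powers:
  assumes q: "prime q" "q dvd n" and pq: "\<not> (p = 2 \<and> q = 3)"
  shows "\<exists>x. coprime x (int q) \<and> (\<forall>c. coprime (1 - \<omega> ^ c * x) (int q))"
proof -
  have q0: "q > 0" using q(1) prime_gt_0_nat by blast
  have "p dvd q - 1" using dvd_prime_divisor_minus_one[OF q] .
  then have "p \<le> q - 1" using q(1) prime_gt_1_nat by (intro dvd_imp_le) auto
  moreover have "p \<noteq> q - 1"
  proof
    assume e: "p = q - 1"
    then have "q = Suc p" using q0 by simp
    then have "even p \<or> even q" by simp
    then have "p = 2 \<or> q = 2"
      using q(1) prime_p by (metis two_is_prime_nat primes_dvd_imp_eq)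
    then show False using pq p_ge_2 \<open>q = Suc p\<close> by auto
  qed
  ultimately have lt: "p < q - 1" by simp
  \<comment> \<open>The set of powers of \<open>\<omega>\<close> is closed under inverses, so it is enough to avoid the powers themselves.\<close>
  let ?B = "(\<lambda>c. \<omega> ^ c mod int q) ` {..<p}"
  have "card ?B \<le> p" using card_image_le[of "{..<p}"] by simp
  then have "card ?B < card {1..<int q}" using lt by simp
  then obtain x where x: "x \<in> {1..<int q}" "x \<notin> ?B"
    by (metis card_mono finite_imageI finite_lessThan linorder_not_le subsetI)
  have "\<not> int q dvd x" using x(1) zdvd_imp_le by fastforce
  then have cx: "coprime x (int q)"
    using q(1) by (metis coprime_commute prime_imp_coprime prime_nat_int_transfer)
  moreover have "coprime (1 - \<omega> ^ c * x) (int q)" for c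
  proof (rule ccontr)
    assume "\<not> coprime (1 - \<omega> ^ c * x) (int q)"
    then have "int q dvd 1 - \<omega> ^ c * x"
      using q(1) by (metis coprime_commute prime_imp_coprime prime_nat_int_transfer)
    then have 1: "[\<omega> ^ c * x = 1] (mod int q)" by (metis cong_iff_dvd_diff cong_sym)
    \<comment> \<open>The power with exponent \<open>c * (p - 1)\<close> is the inverse of \<open>\<omega> ^ c\<close>.\<close>
    let ?e = "c * (p - 1)"
    have "?e + c = p * c" using p_pos by (metis Suc_pred' add.commute mult.commute mult_Suc_right)
    then have "[\<omega> ^ ?e * \<omega> ^ c = 1] (mod int q)"
      using cong_dvd_modulus[OF omega_power_mult_p] q(2) by (simp flip: power_add)
    then have "[\<omega> ^ ?e * \<omega> ^ c * x = 1 * x] (mod int q)" by (rule cong_scalar_right)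
    moreover have "[\<omega> ^ ?e * (\<omega> ^ c * x) = \<omega> ^ ?e * 1] (mod int q)" using 1 by (rule cong_scalar_left)
    ultimately have "[x = \<omega> ^ ?e] (mod int q)" by (metis cong_sym cong_trans mult.assoc mult_1 mult_1_right)
    moreover have "[\<omega> ^ (?e mod p) = \<omega> ^ ?e] (mod int q)"
      using omega_power_mod cong_dvd_modulus q(2) by (metis int_dvd_int_iff)
    ultimately have "x mod int q = \<omega> ^ (?e mod p) mod int q" by (simp add: cong_def)
    moreover have "x mod int q = x" using x(1) by simp
    moreover have "?e mod p < p" using p_pos by simp
    ultimately show False using x(2) by auto
  qed
  ultimately show ?thesis by blast
qed

text \<open>
  At most one entry \<open>d ! i\<close> is divisible by \<open>q\<close>. If there is one, \<open>x\<close> is chosen such that \<open>\<omega> ^ i * x\<close> is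
  congruent to \<open>1 + d ! i\<close>; then \<open>1 - \<omega> ^ c * x\<close> is a unit modulo \<open>q\<close> for every other \<open>c\<close>, because \<open>x\<close> is
  congruent to a power of \<open>\<omega>\<close> modulo \<open>q\<close>.
\<close>

lemma exists_local_unit:
  assumes d: "d \<in> coprime_divisor_tuples n p"
    and three: "p = 2 \<and> n mod 3 = 0 \<Longrightarrow> d \<in> coprime_divisor_tuples3 n p"
    and q: "prime q" "q dvd n" and qk: "q ^ k dvd n"
  shows "\<exists>x. coprime x (int q) \<and>
    (\<forall>c<p. gcd (1 - \<omega> ^ c * x) (int (q ^ k)) = gcd (int (d ! c)) (int (q ^ k)))"
proof (cases "\<exists>i<p. q dvd d ! i")
  case False
  have "\<not> (p = 2 \<and> q = 3)"
  proof
    assume *: "p = 2 \<and> q = 3"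
    then have "n mod 3 = 0" using q(2) by auto
    then show False using three * False by (auto simp: coprime_divisor_tuples3_def)
  qed
  then obtain x where x: "coprime x (int q)" "\<And>c. coprime (1 - \<omega> ^ c * x) (int q)"
    using exists_residue_avoiding_powers[OF q] by blast
  have "gcd (int (d ! c)) (int (q ^ k)) = 1" if "c < p" for c
  proof -
    have "coprime (d ! c) q" using False q(1) that by (metis coprime_commute prime_imp_coprime)
    then have "coprime (d ! c) (q ^ k)" by simp
    then show ?thesis by (metis coprime_imp_gcd_eq_1 gcd_int_int_eq of_nat_1)
  qed
  moreover have "gcd (1 - \<omega> ^ c * x) (int (q ^ k)) = 1" for c
    using x(2)[of c] by (simp add: coprime_iff_gcd_eq_1[symmetric] del: coprime_imp_gcd_eq_1)
  ultimately show ?thesis using x(1) by auto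
next
  case True
  then obtain i where i: "i < p" "q dvd d ! i" by blast
  let ?N = "int (q ^ k)"
  let ?x = "\<omega> ^ (p - i) * (1 + int (d ! i))"
  have qn: "int q dvd int n" using q(2) by simp
  have wq: "coprime (\<omega> ^ j) (int q)" for j
    using coprime_omega qn by (metis coprime_divisors coprime_power_left_iff dvd_refl)
  have 1: "[1 + int (d ! i) = 1] (mod int q)" using i(2) by (simp add: cong_iff_dvd_diff)
  have x1: "[\<omega> ^ c * ?x = \<omega> ^ (c + (p - i)) * 1] (mod int q)" for c
    using cong_scalar_left[OF 1, of "\<omega> ^ (c + (p - i))"] by (simp add: power_add mult.assoc)
  have cop: "coprime (1 + int (d ! i)) (int q)" using cong_imp_coprime[OF cong_sym[OF 1]] by simp
  then have "coprime ?x (int q)" using wq[of "p - i"] by (rule coprime_mult_left_iff[THEN iffD2, OF conjI, rotated])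
  moreover have "gcd (1 - \<omega> ^ c * ?x) ?N = gcd (int (d ! c)) ?N" if c: "c < p" for c
  proof (cases "c = i")
    case True
    show ?thesis
    proof -
      have e: "\<omega> ^ i * ?x = \<omega> ^ p * (1 + int (d ! i))"
        using i(1) by (simp flip: power_add mult.assoc)
      have "[\<omega> ^ p = 1] (mod ?N)" using omega_power_p qk by (metis cong_dvd_modulus int_dvd_int_iff)
      then have "[\<omega> ^ i * ?x = 1 * (1 + int (d ! i))] (mod ?N)" unfolding e by (rule cong_scalar_right)
      then have "[1 - \<omega> ^ i * ?x = 1 - (1 + int (d ! i))] (mod ?N)" by (intro cong_diff) simp_all
      then show ?thesis using cong_gcd_eq[of "1 - \<omega> ^ i * ?x" "- int (d ! i)" ?N] \<open>c = i\<close> by simp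
    qed
  next
    case False
    have "coprime (d ! c) (d ! i)"
      using d c i(1) False by (auto simp: coprime_divisor_tuples_def coprime_iff_gcd_eq_1)
    then have "\<not> q dvd d ! c" using i(2) q(1) by (metis coprime_common_divisor not_prime_unit)
    then have "coprime (d ! c) (q ^ k)" using q(1) by (metis coprime_commute coprime_power_right_iff prime_imp_coprime)
    then have "gcd (int (d ! c)) ?N = 1" by (metis coprime_imp_gcd_eq_1 gcd_int_int_eq of_nat_1)
    moreover have "coprime (1 - \<omega> ^ c * ?x) (int q)"
    proof (rule ccontr)
      assume "\<not> coprime (1 - \<omega> ^ c * ?x) (int q)"
      then have "int q dvd 1 - \<omega> ^ c * ?x"
        using q(1) by (metis coprime_commute prime_imp_coprime prime_nat_int_transfer)
      then have "[\<omega> ^ c * ?x = 1] (mod int q)" by (metis cong_iff_dvd_diff cong_sym)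
      then have "[\<omega> ^ (c + (p - i)) * 1 = \<omega> ^ p * 1] (mod int q)"
        using x1[of c] cong_dvd_modulus[OF omega_power_p qn] by (metis cong_sym cong_trans mult_1_right)
      moreover have "(c + (p - i)) mod p \<noteq> p mod p"
      proof
        assume "(c + (p - i)) mod p = p mod p"
        then have "(c + (p - i) + i) mod p = (p + i) mod p" by (metis mod_add_left_eq)
        then show False using c i(1) False by simp
      qed
      ultimately have "is_unit (int q)" using cong_power_imp_unit[OF qn, of "c + (p - i)" 1 p] by simp
      then show False using q(1) by simp
    qed
    then have "gcd (1 - \<omega> ^ c * ?x) ?N = 1" by simp
    ultimately show ?thesis by simp
  qed
  ultimately show ?thesis by blast
qed

lemma exists_unit_with_fix_counts:
  assumes d: "d \<in> coprime_divisor_tuples n p"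
    and three: "p = 2 \<and> n mod 3 = 0 \<Longrightarrow> d \<in> coprime_divisor_tuples3 n p"
  shows "\<exists>u. coprime u (int n) \<and> fix_counts u = d"
proof -
  have n0: "n > 0" using n_ge_2 by simp
  let ?Q = "\<lambda>q. q ^ multiplicity q n"
  have "\<exists>x. coprime x (int q) \<and>
          (\<forall>c<p. gcd (1 - \<omega> ^ c * x) (int (?Q q)) = gcd (int (d ! c)) (int (?Q q)))"
    if "q \<in> prime_factors n" for q
    using that n0 by (intro exists_local_unit[OF d three] multiplicity_dvd) (auto simp: prime_factors_dvd)
  then obtain x where x: "\<And>q. q \<in> prime_factors n \<Longrightarrow> coprime (x q) (int q)"
    "\<And>q c. q \<in> prime_factors n \<Longrightarrow> c < p \<Longrightarrow>
       gcd (1 - \<omega> ^ c * x q) (int (?Q q)) = gcd (int (d ! c)) (int (?Q q))"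
    by metis
  have "\<forall>i\<in>prime_factors n. \<forall>j\<in>prime_factors n. i \<noteq> j \<longrightarrow> coprime (?Q i) (?Q j)"
    by (auto intro!: coprime_power_left_iff[THEN iffD2] coprime_power_right_iff[THEN iffD2] disjI1
        intro: primes_coprime in_prime_factors_imp_prime)
  then obtain y where y: "\<forall>q\<in>prime_factors n. [y = nat (x q mod int (?Q q))] (mod ?Q q)"
    using chinese_remainder_nat[of "prime_factors n" ?Q "\<lambda>q. nat (x q mod int (?Q q))"] by auto
  have yx: "[int y = x q] (mod int (?Q q))" if "q \<in> prime_factors n" for q
  proof -
    have "?Q q > 0" using that by (simp add: in_prime_factors_imp_prime prime_gt_0_nat)
    then have "int (nat (x q mod int (?Q q))) = x q mod int (?Q q)" by simp
    moreover have "[int y = int (nat (x q mod int (?Q q)))] (mod int (?Q q))"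
      using y that by (simp only: cong_int_iff)
    ultimately show ?thesis by (metis cong_mod_right)
  qed
  have "coprime (int y) (int n)"
  proof (rule ccontr)
    assume "\<not> coprime (int y) (int n)"
    then have "\<not> coprime y n" by (simp only: coprime_int_iff not_False_eq_True)
    then have "gcd y n \<noteq> 1" by (simp add: coprime_iff_gcd_eq_1)
    then obtain q where "prime q" "q dvd gcd y n" using prime_factor_nat by blast
    then have q: "prime q" "q dvd y" "q dvd n" by auto
    then have qn: "q \<in> prime_factors n" using n0 by (simp add: prime_factors_dvd)
    have "q dvd ?Q q" using q n0 by (simp add: prime_multiplicity_gt_zero_iff)
    then have "[int y = x q] (mod int q)" using yx[OF qn] by (metis cong_dvd_modulus int_dvd_int_iff)
    then have "int q dvd int y \<longleftrightarrow> int q dvd x q" by (rule cong_dvd_iff)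
    then have "int q dvd x q" using q(2) by simp
    then have "is_unit (int q)" using coprime_common_divisor[OF x(1)[OF qn], of "int q"] by simp
    then show False using q(1) by simp
  qed
  moreover have "fix_count (int y) c = d ! c" if c: "c < p" for c
  proof -
    let ?s = "nat \<bar>1 - \<omega> ^ c * int y\<bar>"
    have "gcd ?s n = gcd (d ! c) n"
    proof (rule gcd_eq_if_prime_power_gcd_eq[OF n0])
      fix q assume "prime q" "q dvd n"
      then have q: "q \<in> prime_factors n" using n0 by (simp add: prime_factors_dvd)
      have "[1 - \<omega> ^ c * int y = 1 - \<omega> ^ c * x q] (mod int (?Q q))"
        using yx[OF q] by (intro cong_diff cong_scalar_left) simp_all
      then have "gcd (1 - \<omega> ^ c * int y) (int (?Q q)) = gcd (int (d ! c)) (int (?Q q))"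
        using x(2)[OF q c] by (simp only: cong_gcd_eq)
      then show "gcd ?s (?Q q) = gcd (d ! c) (?Q q)"
        by (simp only: gcd_int_def abs_of_nat nat_int of_nat_eq_iff)
    qed
    moreover have "gcd (d ! c) n = d ! c"
      using d c by (simp add: coprime_divisor_tuples_def gcd_nat.absorb1)
    moreover have "fix_count (int y) c = gcd ?s n"
      by (simp only: fix_count_def gcd_int_def abs_of_nat nat_int)
    ultimately show ?thesis by simp
  qed
  then have "fix_counts (int y) = d"
    using d by (auto simp: fix_counts_def coprime_divisor_tuples_def intro!: nth_equalityI)
  ultimately show ?thesis by blast
qed

lemma fix_counts_range:
  "fix_counts ` {u. coprime u (int n)} =
    (if p = 2 \<and> n mod 3 = 0 then coprime_divisor_tuples3 n p else coprime_divisor_tuples n p)"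
  (is "?L = ?R")
proof (intro subset_antisym subsetI)
  fix d assume "d \<in> ?L"
  then obtain u where u: "coprime u (int n)" "d = fix_counts u" by blast
  have "\<exists>i<p. d ! i mod 3 = 0" if "p = 2" "n mod 3 = 0"
    using three_dvd_fix_count[OF that u(1)] unfolding u(2)
    by (auto simp: fix_counts_def mod_eq_0_iff_dvd)
  then show "d \<in> ?R"
    using fix_counts_in_coprime_divisor_tuples[of u] u(2) by (auto simp: coprime_divisor_tuples3_def)
next
  fix d assume d: "d \<in> ?R"
  then have "d \<in> coprime_divisor_tuples n p"
    by (auto simp: coprime_divisor_tuples3_def split: if_splits)
  moreover have "d \<in> coprime_divisor_tuples3 n p" if "p = 2 \<and> n mod 3 = 0"
    using d that by simp
  ultimately obtain u where "coprime u (int n)" "fix_counts u = d"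
    using exists_unit_with_fix_counts by blast
  then show "d \<in> ?L" by blast
qed

end

section \<open>Counting orbits of the reduced action\<close>

text \<open>
  Pulling back along a surjection \<open>\<rho>\<close> that both respects and reflects the relations matches the
  classes, since each class upstairs is a full preimage.
\<close>

lemma quotient_eq_image_of_reduction:
  assumes "\<rho> ` A = S" "r \<subseteq> A \<times> A"
    and rel: "\<And>x y. x \<in> A \<Longrightarrow> y \<in> A \<Longrightarrow> (x, y) \<in> r \<longleftrightarrow> (\<rho> x, \<rho> y) \<in> s"
  shows "A // r = (\<lambda>X. A \<inter> \<rho> -` X) ` (S // s)"
proof -
  have "r `` {x} = A \<inter> \<rho> -` (s `` {\<rho> x})" if "x \<in> A" for x
    using that assms by auto
  then have "(\<lambda>x. r `` {x}) ` A = (\<lambda>X. A \<inter> \<rho> -` X) ` (\<lambda>x. s `` {x}) ` \<rho> ` A"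
    unfolding image_image by (intro image_cong) auto
  moreover have "A // r = (\<lambda>x. r `` {x}) ` A" "S // s = (\<lambda>x. s `` {x}) ` S"
    by (auto simp: quotient_def)
  ultimately show ?thesis using assms(1) by simp
qed

lemma card_quotient_reduction:
  assumes "\<rho> ` A = S" "r \<subseteq> A \<times> A" "s \<subseteq> S \<times> S"
    and "\<And>x y. x \<in> A \<Longrightarrow> y \<in> A \<Longrightarrow> (x, y) \<in> r \<longleftrightarrow> (\<rho> x, \<rho> y) \<in> s"
  shows "card (A // r) = card (S // s)"
proof -
  have "inj_on (\<lambda>X. A \<inter> \<rho> -` X) (S // s)"
  proof (rule inj_on_inverseI)
    fix X assume "X \<in> S // s"
    then have "X \<subseteq> S" using assms(3) by (auto simp: quotient_def)
    then show "\<rho> ` (A \<inter> \<rho> -` X) = X" using assms(1) by auto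
  qed
  then show ?thesis
    using quotient_eq_image_of_reduction[OF assms(1,2,4)] by (simp add: card_image)
qed

lemma card_quotient_eq_sum_inverse_class_card:
  assumes "finite S" "equiv S s"
  shows "real (card (S // s)) = (\<Sum>x\<in>S. 1 / real (card (s `` {x})))"
proof -
  have fin: "finite X" if "X \<in> S // s" for X
    using that assms by (meson finite_subset in_quotient_imp_subset)
  have "(\<Sum>x\<in>S. 1 / real (card (s `` {x}))) = (\<Sum>x\<in>\<Union>(S // s). 1 / real (card (s `` {x})))"
    using assms(2) by (simp add: Union_quotient)
  also have "\<dots> = (\<Sum>X\<in>S // s. \<Sum>x\<in>X. 1 / real (card (s `` {x})))"
    using fin quotient_disj[OF assms(2)] by (subst sum.Union_disjoint) auto
  also have "\<dots> = (\<Sum>X\<in>S // s. 1)"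
  proof (rule sum.cong[OF refl])
    fix X assume X: "X \<in> S // s"
    have "s `` {x} = X" if "x \<in> X" for x
      using X that assms(2) by (metis (no_types, lifting) Image_singleton_iff equiv_class_eq quotientE)
    moreover have "X \<noteq> {}" using X assms(2) by (rule in_quotient_imp_non_empty[rotated])
    ultimately show "(\<Sum>x\<in>X. 1 / real (card (s `` {x}))) = 1" using fin[OF X] by simp
  qed
  finally show ?thesis by simp
qed

text \<open>
  The multiples of \<open>t\<close> modulo \<open>N\<close> are the multiples of \<open>gcd t N\<close> (Bezout), so solvability in \<open>k\<close> is a congruence.
\<close>

lemma exists_cong_add_mult_iff:
  fixes x y t N :: int
  shows "(\<exists>k. [x = y + t * k] (mod N)) \<longleftrightarrow> [x = y] (mod gcd t N)"
proof
  assume "\<exists>k. [x = y + t * k] (mod N)"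
  then obtain k where "[x = y + t * k] (mod N)" ..
  then have "[x = y + t * k] (mod gcd t N)" by (rule cong_dvd_modulus) simp
  moreover have "[y + t * k = y] (mod gcd t N)" by (simp add: cong_iff_dvd_diff)
  ultimately show "[x = y] (mod gcd t N)" by (rule cong_trans)
next
  assume "[x = y] (mod gcd t N)"
  then have "gcd t N dvd x - y" by (simp add: cong_iff_dvd_diff)
  then obtain k where "[t * k = x - y] (mod N)" using cong_solve_dvd_int by blast
  then have "[y + t * k = y + (x - y)] (mod N)" by (intro cong_add) simp_all
  then show "\<exists>k. [x = y + t * k] (mod N)" by (auto intro: cong_sym)
qed

text \<open>
  What remains of the set of group elements after dividing out the twisted conjugations by \<open>C\<^sub>n\<close> and
  \<open>C\<^bsub>p^m\<^esub>\<close>: one copy of \<open>C\<^bsub>D c\<^esub> \<times> C\<^sub>P\<close> for each of the \<open>p\<close> cosets of the base group.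
\<close>

definition reduced_set :: "nat \<Rightarrow> (nat \<Rightarrow> nat) \<Rightarrow> nat \<Rightarrow> (nat \<times> int \<times> int) set" where
  "reduced_set p D P = Sigma {..<p} (\<lambda>c. {0..<int (D c)} \<times> {0..<int P})"

text \<open>
  The orbit relation of the action of \<open>C\<^sub>p\<close> that is left on the reduced set. On the first coordinate it
  multiplies by \<open>w\<close>, on the second it translates by \<open>- b\<close>. The exponent ranges over all natural numbers
  so that composition of two steps needs no reduction modulo \<open>p\<close>.
\<close>

definition reduced_rel ::
    "int \<Rightarrow> int \<Rightarrow> nat \<Rightarrow> (nat \<Rightarrow> nat) \<Rightarrow> nat \<Rightarrow> ((nat \<times> int \<times> int) \<times> (nat \<times> int \<times> int)) set" where
  "reduced_rel w b p D P = {((c, X, Z), (c', X', Z')).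
     (c, X, Z) \<in> reduced_set p D P \<and> (c', X', Z') \<in> reduced_set p D P \<and> c = c' \<and>
     (\<exists>k. [X = w ^ k * X'] (mod int (D c)) \<and> [Z = Z' - b * int k] (mod int P))}"

context fixed_point_free_unit
begin

context
  fixes b :: int and D :: "nat \<Rightarrow> nat" and P :: nat
  assumes D_dvd: "\<And>c. c < p \<Longrightarrow> D c dvd n"
    and P_pos: "P > 0" and P_dvd_pb: "int P dvd int p * b"
begin

abbreviation (input) "points \<equiv> reduced_set p D P"
abbreviation (input) "orbit_rel \<equiv> reduced_rel \<omega> b p D P"

lemma finite_reduced_set: "finite points"
  by (simp add: reduced_set_def)

lemma int_D_dvd: "c < p \<Longrightarrow> int (D c) dvd int n"
  using D_dvd by simp

lemma D_pos: "c < p \<Longrightarrow> D c > 0"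
  using D_dvd n_ge_2 by (metis dvd_0_left_iff neq0_conv not_numeral_le_zero)

lemma omega_power_cong_D:
  "c < p \<Longrightarrow> [i = j] (mod p) \<Longrightarrow> [\<omega> ^ i = \<omega> ^ j] (mod int (D c))"
  using omega_power_cong int_D_dvd cong_dvd_modulus by blast

lemma b_mult_cong:
  assumes "[i = j] (mod p)" shows "[b * int i = b * int j] (mod int P)"
proof -
  have "int p dvd int i - int j" using assms by (simp add: cong_iff_dvd_diff flip: cong_int_iff)
  then have "int p * b dvd (int i - int j) * b" by (rule mult_dvd_mono) simp
  then have "int P dvd (int i - int j) * b" using P_dvd_pb by (rule dvd_trans[rotated])
  then show ?thesis by (simp add: cong_iff_dvd_diff algebra_simps)
qed

lemma equiv_reduced_rel: "equiv points orbit_rel"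
proof (rule equivI)
  show "orbit_rel \<subseteq> points \<times> points" by (auto simp: reduced_rel_def)
  show "refl_on points orbit_rel"
    by (rule refl_onI) (auto simp: reduced_rel_def intro!: exI[of _ "0::nat"])
  show "sym orbit_rel"
  proof (rule symI)
    fix x y assume "(x, y) \<in> orbit_rel"
    then obtain c X Z X' Z' k where xy: "x = (c, X, Z)" "y = (c, X', Z')" "x \<in> points" "y \<in> points"
      and 1: "[X = \<omega> ^ k * X'] (mod int (D c))" and 2: "[Z = Z' - b * int k] (mod int P)"
      by (auto simp: reduced_rel_def)
    have c: "c < p" using xy by (auto simp: reduced_set_def)
    \<comment> \<open>The additive inverse of \<open>k\<close> modulo \<open>p\<close> as a natural number.\<close>
    let ?l = "(p - 1) * k"
    have kl: "?l + k = p * k" using p_pos by (cases p) auto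
    have "[\<omega> ^ ?l * X = \<omega> ^ ?l * (\<omega> ^ k * X')] (mod int (D c))" using 1 by (rule cong_scalar_left)
    also have "\<omega> ^ ?l * (\<omega> ^ k * X') = \<omega> ^ (p * k) * X'" by (simp flip: kl add: power_add mult.assoc)
    also have "[\<omega> ^ (p * k) * X' = \<omega> ^ 0 * X'] (mod int (D c))"
      using c by (intro cong_scalar_right omega_power_cong_D) (simp_all add: cong_def)
    finally have a: "[X' = \<omega> ^ ?l * X] (mod int (D c))" by (simp add: cong_sym_eq)
    have "[Z - b * int ?l = Z' - b * int k - b * int ?l] (mod int P)" using 2 by (intro cong_diff) simp_all
    also have "Z' - b * int k - b * int ?l = Z' - b * int (p * k)"
      unfolding kl[symmetric] by (simp add: algebra_simps)
    also have "[Z' - b * int (p * k) = Z' - b * int 0] (mod int P)"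
      by (intro cong_diff b_mult_cong) (simp_all add: cong_def)
    finally have "[Z' = Z - b * int ?l] (mod int P)" by (simp add: cong_sym_eq)
    with a xy show "(y, x) \<in> orbit_rel" by (auto simp: reduced_rel_def)
  qed
  show "trans orbit_rel"
  proof (rule transI)
    fix x y z assume "(x, y) \<in> orbit_rel" "(y, z) \<in> orbit_rel"
    then obtain c X Z X' Z' X'' Z'' k l
      where xyz: "x = (c, X, Z)" "y = (c, X', Z')" "z = (c, X'', Z'')" "x \<in> points" "z \<in> points"
      and 1: "[X = \<omega> ^ k * X'] (mod int (D c))" "[Z = Z' - b * int k] (mod int P)"
      and 2: "[X' = \<omega> ^ l * X''] (mod int (D c))" "[Z' = Z'' - b * int l] (mod int P)"
      by (fastforce simp: reduced_rel_def)
    have "[X = \<omega> ^ (k + l) * X''] (mod int (D c))"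
      using cong_trans[OF 1(1) cong_scalar_left[OF 2(1)]] by (simp add: power_add mult.assoc)
    moreover have "[Z' - b * int k = Z'' - b * int l - b * int k] (mod int P)"
      using 2 by (intro cong_diff) simp_all
    then have "[Z = Z'' - b * int (k + l)] (mod int P)"
      using 1(2) cong_trans by (fastforce simp: algebra_simps)
    ultimately show "(x, z) \<in> orbit_rel" using xyz by (auto simp: reduced_rel_def)
  qed
qed

lemma reduced_class_eq:
  assumes x: "(c, X, Z) \<in> points"
  shows "orbit_rel `` {(c, X, Z)} =
    (\<lambda>k. (c, \<omega> ^ k * X mod int (D c), (Z - b * int k) mod int P)) ` {..<p}" (is "_ = ?f ` _")
proof -
  have c: "c < p" using x by (auto simp: reduced_set_def)
  have m: "?f k \<in> points" for k
    using c D_pos[OF c] P_pos by (auto simp: reduced_set_def)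
  have "orbit_rel `` {(c, X, Z)} = orbit_rel\<inverse> `` {(c, X, Z)}"
    using equiv_reduced_rel by (simp add: equiv_def sym_conv_converse_eq)
  also have "\<dots> = ?f ` {..<p}"
  proof (intro subset_antisym subsetI)
    fix y assume "y \<in> orbit_rel\<inverse> `` {(c, X, Z)}"
    then obtain X' Z' k where y: "y = (c, X', Z')" "y \<in> points"
      and 1: "[X' = \<omega> ^ k * X] (mod int (D c))" "[Z' = Z - b * int k] (mod int P)"
      by (auto simp: reduced_rel_def)
    have "[\<omega> ^ k * X = \<omega> ^ (k mod p) * X] (mod int (D c))"
      using c by (intro cong_scalar_right omega_power_cong_D) (simp_all add: cong_def)
    then have "[X' = \<omega> ^ (k mod p) * X] (mod int (D c))" using 1 cong_trans by blast
    then have "X' = \<omega> ^ (k mod p) * X mod int (D c)"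
      using y by (auto simp: cong_def reduced_set_def)
    moreover have "[Z - b * int k = Z - b * int (k mod p)] (mod int P)"
      by (intro cong_diff b_mult_cong) (simp_all add: cong_def)
    then have "[Z' = Z - b * int (k mod p)] (mod int P)" using 1 cong_trans by blast
    then have "Z' = (Z - b * int (k mod p)) mod int P"
      using y by (auto simp: cong_def reduced_set_def)
    ultimately show "y \<in> ?f ` {..<p}" using y(1) p_pos by auto
  next
    fix y assume "y \<in> ?f ` {..<p}"
    then obtain k where y: "y = ?f k" by blast
    show "y \<in> orbit_rel\<inverse> `` {(c, X, Z)}"
      using m[of k] x unfolding y by (auto simp: reduced_rel_def intro!: exI[of _ k])
  qed
  finally show ?thesis .
qed

text \<open>
  An orbit of \<open>C\<^sub>p\<close> has \<open>1\<close> or \<open>p\<close> points. The translation is free unless \<open>P\<close> divides \<open>b\<close>, and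
  multiplication by \<open>\<omega> ^ k\<close> with \<open>p\<close> not dividing \<open>k\<close> fixes only \<open>0\<close>.
\<close>

lemma card_reduced_class:
  assumes P: "P dvd p ^ m" and x: "(c, X, Z) \<in> points"
  shows "card (orbit_rel `` {(c, X, Z)}) = (if X = 0 \<and> int P dvd b then 1 else p)"
proof -
  let ?f = "\<lambda>k. (c, \<omega> ^ k * X mod int (D c), (Z - b * int k) mod int P)"
  have c: "c < p" and X: "0 \<le> X" "X < int (D c)" and Z: "0 \<le> Z" "Z < int P"
    using x by (auto simp: reduced_set_def)
  show ?thesis
  proof (cases "X = 0 \<and> int P dvd b")
    case True
    have "(Z - b * int k) mod int P = Z" for k
    proof -
      have "[Z - b * int k = Z - 0] (mod int P)"
        using True by (intro cong_diff) (simp_all add: cong_0_iff)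
      then show ?thesis using Z by (simp add: cong_def)
    qed
    then have "?f ` {..<p} = {(c, 0, Z)}" using True p_pos by auto
    then have "orbit_rel `` {(c, X, Z)} = {(c, 0, Z)}" unfolding reduced_class_eq[OF x] .
    then show ?thesis using True by simp
  next
    case False
    have "inj_on ?f {..<p}"
    proof (rule linorder_inj_onI)
      fix k l assume kl: "k < l" "k \<in> {..<p}" "l \<in> {..<p}"
      show "?f k \<noteq> ?f l"
      proof
        assume eq: "?f k = ?f l"
        have nd: "\<not> p dvd l - k" using kl by (auto dest: dvd_imp_le)
        show False
        proof (cases "X = 0")
          case True
          with False have "\<not> int P dvd b" by simp
          have "[Z - b * int k = Z - b * int l] (mod int P)" using eq by (simp add: cong_def)
          then have "int P dvd b * int (l - k)"
            using kl by (simp add: cong_iff_dvd_diff algebra_simps of_nat_diff)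
          moreover have "coprime (p ^ m) (l - k)" using prime_imp_coprime[OF prime_p nd] by simp
          then have "coprime P (l - k)" using P by (meson coprime_divisors dvd_refl)
          then have "coprime (int P) (int (l - k))" by (simp only: coprime_int_iff)
          ultimately have "int P dvd b" by (simp add: coprime_dvd_mult_left_iff)
          then show False using \<open>\<not> int P dvd b\<close> by simp
        next
          case False
          have "[\<omega> ^ l * X = \<omega> ^ k * X] (mod int (D c))" using eq by (simp add: cong_def)
          then have "int (D c) dvd \<omega> ^ l * X - \<omega> ^ k * X" by (simp add: cong_iff_dvd_diff)
          also have "\<omega> ^ l * X - \<omega> ^ k * X = \<omega> ^ k * (\<omega> ^ (l - k) - 1) * X"
            using kl(1) by (simp add: algebra_simps flip: power_add)
          finally have "int (D c) dvd \<omega> ^ k * (\<omega> ^ (l - k) - 1) * X" .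
          moreover have "coprime (\<omega> ^ k * (\<omega> ^ (l - k) - 1)) (int n)"
            using coprime_omega coprime_omega_power_minus_one[OF nd] by simp
          then have "coprime (int (D c)) (\<omega> ^ k * (\<omega> ^ (l - k) - 1))"
            using int_D_dvd[OF c] by (meson coprime_commute coprime_divisors dvd_refl)
          ultimately have "int (D c) dvd X" by (simp add: coprime_dvd_mult_right_iff)
          then show False using X False zdvd_imp_le by fastforce
        qed
      qed
    qed auto
    then show ?thesis using False by (simp only: reduced_class_eq[OF x] card_image) simp
  qed
qed

text \<open>
  Summing the inverse orbit sizes. When \<open>P\<close> divides \<open>b\<close>, each coset contributes \<open>P\<close> fixed points and
  \<open>P * (D c - 1) / p\<close> orbits of length \<open>p\<close>; otherwise all orbits have length \<open>p\<close>.
\<close>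

lemma card_reduced_quotient:
  assumes P: "P dvd p ^ m"
  shows "real (card (points // orbit_rel)) =
    (if int P dvd b then real P * (real p + (real (\<Sum>c<p. D c) - real p) / real p)
     else real P * real (\<Sum>c<p. D c) / real p)"
proof -
  let ?g = "\<lambda>X. 1 / real (if X = (0::int) \<and> int P dvd b then 1 else p)"
  have "real (card (points // orbit_rel)) = (\<Sum>x\<in>points. ?g (fst (snd x)))"
    unfolding card_quotient_eq_sum_inverse_class_card[OF finite_reduced_set equiv_reduced_rel]
    by (rule sum.cong[OF refl]) (use card_reduced_class[OF P] in auto)
  also have "\<dots> = (\<Sum>c<p. \<Sum>y\<in>{0..<int (D c)} \<times> {0..<int P}. ?g (fst y))"
    unfolding reduced_set_def by (subst sum.Sigma) (auto intro!: sum.cong)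
  also have "\<dots> = (\<Sum>c<p. \<Sum>X\<in>{0..<int (D c)}. real P * ?g X)"
    by (simp add: sum.cartesian_product')
  also have "\<dots> = (if int P dvd b then real P * (real p + (real (\<Sum>c<p. D c) - real p) / real p)
     else real P * real (\<Sum>c<p. D c) / real p)"
  proof (cases "int P dvd b")
    case True
    have "(\<Sum>X\<in>{0..<int (D c)}. real P * ?g X) = real P * (1 + (real (D c) - 1) / real p)"
      if c: "c < p" for c
    proof -
      have "{0..<int (D c)} = insert 0 {1..<int (D c)}" using D_pos[OF c] by auto
      then have "(\<Sum>X\<in>{0..<int (D c)}. real P * ?g X)
          = real P + (\<Sum>X\<in>{1..<int (D c)}. real P * ?g X)"
        using True by simp
      also have "(\<Sum>X\<in>{1..<int (D c)}. real P * ?g X) = (\<Sum>X\<in>{1..<int (D c)}. real P / real p)"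
        by (rule sum.cong) auto
      finally show ?thesis using D_pos[OF c] by (simp add: algebra_simps of_nat_diff)
    qed
    then have "(\<Sum>c<p. \<Sum>X\<in>{0..<int (D c)}. real P * ?g X)
        = (\<Sum>c<p. real P * (1 + (real (D c) - 1) / real p))" by (intro sum.cong) auto
    also have "\<dots> = real P * (real p + (real (\<Sum>c<p. D c) - real p) / real p)"
      by (simp add: sum.distrib sum_subtractf flip: sum_distrib_left sum_divide_distrib)
    finally show ?thesis using True by simp
  qed (simp add: sum_distrib_left sum_divide_distrib mult.commute)
  finally show ?thesis .
qed

end
end

section \<open>The group in coordinates\<close>

text \<open>
  The group with its action written out. \<open>C\<^sub>p\<close> fixes \<open>C\<^bsub>p^m\<^esub>\<close> pointwise, so the group is in effect the direct product of
  \<open>C\<^bsub>p^m\<^esub>\<close> and a Frobenius group.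
\<close>

locale smc_coordinates = fixed_point_free_unit n p \<omega> for n p :: nat and \<omega> :: int +
  fixes m :: nat and \<alpha> :: "int \<Rightarrow> int \<times> int \<Rightarrow> int \<times> int"
  assumes coprime_n_p: "coprime n p"
    and action_eq: "\<And>c x z. c < p \<Longrightarrow> x \<in> {0..<int n} \<Longrightarrow> z \<in> {0..<int (p ^ m)} \<Longrightarrow>
           \<alpha> (int c) (x, z) = (\<omega> ^ c * x mod int n, z)"
begin

abbreviation "G \<equiv> SMC_group n m p \<alpha>"

abbreviation "q \<equiv> int (p ^ m)"

lemma q_pos: "q > 0" using p_pos by simp

lemma n_pos: "int n > 0" using n_ge_2 by simp

text \<open>
  Accepting unreduced coordinates turns all calculations in the group into congruences between integers.
\<close>

definition E :: "int \<Rightarrow> int \<Rightarrow> nat \<Rightarrow> (int \<times> int) \<times> int" where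
  "E x z c = ((x mod int n, z mod q), int (c mod p))"

lemma carrier_G: "carrier G = ({0..<int n} \<times> {0..<q}) \<times> {0..<int p}"
  using n_pos p_pos
  by (simp add: SMC_group_def semidirect_product_def DirProd_def carrier_integer_mod_group)

lemma E_closed [simp]: "E x z c \<in> carrier G"
  using n_pos q_pos p_pos by (simp add: carrier_G E_def)

lemma carrier_E:
  assumes "g \<in> carrier G" obtains x z c where "g = E x z c" "c < p"
proof -
  obtain x z c where g: "g = ((x, z), c)" by (metis surj_pair)
  then have "g = E x z (nat c)" "nat c < p" using assms p_pos by (auto simp: carrier_G E_def)
  then show thesis by (rule that)
qed

lemma E_eq_iff:
  "E x z c = E x' z' c' \<longleftrightarrow> [x = x'] (mod int n) \<and> [z = z'] (mod q) \<and> [c = c'] (mod p)"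
  by (simp add: E_def cong_def)

lemma one_G: "\<one>\<^bsub>G\<^esub> = E 0 0 0"
  by (simp add: SMC_group_def semidirect_product_def DirProd_def E_def)

lemma E_mult: "E x z c \<otimes>\<^bsub>G\<^esub> E y w k = E (x + \<omega> ^ c * y) (z + w) (c + k)"
proof -
  have "\<alpha> (int (c mod p)) (y mod int n, w mod q) = (\<omega> ^ (c mod p) * (y mod int n) mod int n, w mod q)"
    using n_pos q_pos p_pos by (intro action_eq) simp_all
  moreover have "[x mod int n + \<omega> ^ (c mod p) * (y mod int n) mod int n = x + \<omega> ^ c * y] (mod int n)"
    using cong_mult[OF omega_power_mod cong_mod_left[THEN iffD2, OF cong_refl]]
    by (intro cong_add) simp_all
  ultimately show ?thesis
    by (simp add: E_def SMC_group_def semidirect_product_def DirProd_def cong_def mod_simps zmod_int)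
qed

lemma group_G: "group G"
proof (rule groupI)
  fix g h k assume "g \<in> carrier G" "h \<in> carrier G" "k \<in> carrier G"
  then show "g \<otimes>\<^bsub>G\<^esub> h \<otimes>\<^bsub>G\<^esub> k = g \<otimes>\<^bsub>G\<^esub> (h \<otimes>\<^bsub>G\<^esub> k)"
    by (elim carrier_E) (simp add: E_mult algebra_simps power_add)
next
  fix g assume "g \<in> carrier G"
  then obtain x z c where g: "g = E x z c" by (elim carrier_E)
  \<comment> \<open>The additive inverse of \<open>c\<close> modulo \<open>p\<close> as a natural number.\<close>
  let ?e = "(p - 1) * c"
  have "?e + c = p * c" using p_pos by (cases p) auto
  then have "E (- (\<omega> ^ ?e) * x) (- z) ?e \<otimes>\<^bsub>G\<^esub> g = \<one>\<^bsub>G\<^esub>"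
    unfolding g E_mult one_G E_eq_iff by (simp add: cong_def)
  then show "\<exists>h\<in>carrier G. h \<otimes>\<^bsub>G\<^esub> g = \<one>\<^bsub>G\<^esub>" using E_closed by blast
qed (auto simp: one_G E_mult elim!: carrier_E)

sublocale G: group G by (rule group_G)

lemma E_pow: "E x z c [^]\<^bsub>G\<^esub> (i::nat) = E (x * (\<Sum>j<i. \<omega> ^ (c * j))) (int i * z) (c * i)"
  by (induction i) (simp_all add: one_G E_mult algebra_simps)

text \<open>
  The first coordinate of the \<open>k\<close>-th power of an element of \<open>C\<^sub>n\<close> times the generator of \<open>C\<^sub>p\<close>
  is a multiple of this geometric sum.
\<close>

definition gsum :: "nat \<Rightarrow> int" where "gsum k = (\<Sum>j<k. \<omega> ^ j)"

lemma gsum_mult: "(\<omega> - 1) * gsum k = \<omega> ^ k - 1"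
  by (simp add: gsum_def power_diff_1_eq)

text \<open>
  Three structural facts determine an automorphism \<open>\<phi>\<close>. It preserves \<open>C\<^sub>n\<close>, the set of elements of order
  dividing \<open>n\<close>. On \<open>C\<^sub>n\<close> it is a multiplication and so commutes with the action; hence conjugation by \<open>\<phi> g\<close> acts there exactly as
  conjugation by \<open>g\<close> does, which forces the \<open>C\<^sub>p\<close>-coordinate to be preserved. And it preserves the
  centre, which is \<open>C\<^bsub>p^m\<^esub>\<close>. What is left free are a unit \<open>u\<close> on \<open>C\<^sub>n\<close>, a unit \<open>v\<close> on the centre, and the
  image of the generator of \<open>C\<^sub>p\<close>, whose central component \<open>b\<close> must have order dividing \<open>p\<close>.
\<close>

lemma automorphism_form:
  assumes phi: "\<phi> \<in> auto G"
  shows "\<exists>u v a b. coprime u (int n) \<and> coprime v q \<and> q dvd int p * b \<and>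
    (\<forall>x z c. \<phi> (E x z c) = E (u * x + a * gsum c) (v * z + b * int c) c)"
proof -
  have hom: "\<phi> \<in> hom G G" and bij: "bij_betw \<phi> (carrier G) (carrier G)"
    using phi by (auto simp: auto_def Bij_def)
  interpret phi: group_hom G G \<phi> by unfold_locales (rule hom)
  have inj: "\<phi> (E x z c) = \<phi> (E x' z' c') \<Longrightarrow> E x z c = E x' z' c'" for x z c x' z' c'
    using bij by (meson E_closed bij_betw_def inj_onD)
  have mult: "\<phi> (E x z c \<otimes>\<^bsub>G\<^esub> E x' z' c') = \<phi> (E x z c) \<otimes>\<^bsub>G\<^esub> \<phi> (E x' z' c')" for x z c x' z' c'
    by (rule hom_mult[OF hom]) simp_all
  have pow: "\<phi> (E x z c [^]\<^bsub>G\<^esub> (i::nat)) = \<phi> (E x z c) [^]\<^bsub>G\<^esub> i" for x z c i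
    by (rule phi.hom_nat_pow) simp
  have one: "\<phi> (E 0 0 0) = E 0 0 0" using phi.hom_one by (simp add: one_G)
  have ex: "\<exists>x z c. \<phi> (E x' z' c') = E x z c" for x' z' c'
    by (metis E_closed carrier_E phi.hom_closed)
  \<comment> \<open>The image of a generator of \<open>C\<^sub>n\<close> has order dividing \<open>n\<close>, which is coprime to \<open>p\<close>.\<close>
  obtain u t k where 0: "\<phi> (E 1 0 0) = E u t k" using ex by blast
  have "E 1 0 0 [^]\<^bsub>G\<^esub> n = E 0 0 0" by (simp add: E_pow E_eq_iff cong_0_iff)
  then have "E u t k [^]\<^bsub>G\<^esub> n = E 0 0 0" using pow[of 1 0 0 n] 0 one by simp
  then have "q dvd int n * t" "p dvd k * n" by (simp_all add: E_pow E_eq_iff cong_0_iff)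
  moreover have "coprime q (int n)" using coprime_n_p by (simp add: coprime_commute)
  moreover have "coprime p n" using coprime_n_p by (simp add: coprime_commute)
  ultimately have "q dvd t" "p dvd k" by (simp_all add: coprime_dvd_mult_right_iff coprime_dvd_mult_left_iff)
  then have phi_u1: "\<phi> (E 1 0 0) = E u 0 0" using 0 by (simp add: E_eq_iff cong_0_iff)
  have phi_u: "\<phi> (E x 0 0) = E (u * x) 0 0" for x
  proof -
    let ?i = "nat (x mod int n)"
    have i: "int ?i = x mod int n" using n_pos by simp
    have "E x 0 0 = E 1 0 0 [^]\<^bsub>G\<^esub> ?i" by (simp add: E_pow E_eq_iff i del: int_nat_eq)
    then have "\<phi> (E x 0 0) = E u 0 0 [^]\<^bsub>G\<^esub> ?i" using pow phi_u1 by simp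
    also have "\<dots> = E (u * x) 0 0"
      by (simp add: E_pow E_eq_iff i cong_def mod_mult_right_eq del: int_nat_eq)
    finally show ?thesis .
  qed
  have cu: "coprime u (int n)"
  proof (rule coprime_if_mult_inj_mod[OF n_pos])
    fix x assume "int n dvd u * x"
    then have "\<phi> (E x 0 0) = \<phi> (E 0 0 0)" using phi_u[of x] one by (simp add: E_eq_iff cong_0_iff)
    then show "int n dvd x" using inj by (metis E_eq_iff cong_0_iff)
  qed
  have same_power: "[i = j] (mod p)" if "[\<omega> ^ i * u = \<omega> ^ j * u] (mod int n)" for i j
  proof (rule ccontr)
    assume "\<not> [i = j] (mod p)"
    then have "is_unit (int n)" using cong_power_imp_unit[OF dvd_refl that cu] by (simp add: cong_def)
    then show False using n_ge_2 by simp
  qed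
  \<comment> \<open>The image of the generator of \<open>C\<^sub>p\<close> still conjugates \<open>C\<^sub>n\<close> by \<open>\<omega>\<close>.\<close>
  obtain a b c1 where phi1: "\<phi> (E 0 0 1) = E a b c1" using ex by blast
  have "E 0 0 1 \<otimes>\<^bsub>G\<^esub> E 1 0 0 = E \<omega> 0 0 \<otimes>\<^bsub>G\<^esub> E 0 0 1" by (simp add: E_mult)
  then have "E a b c1 \<otimes>\<^bsub>G\<^esub> E u 0 0 = E (u * \<omega>) 0 0 \<otimes>\<^bsub>G\<^esub> E a b c1"
    by (metis mult phi1 phi_u phi_u1)
  then have "[a + \<omega> ^ c1 * u = a + \<omega> ^ 1 * u] (mod int n)" by (simp add: E_mult E_eq_iff ac_simps)
  then have "[c1 = 1] (mod p)" by (intro same_power) (simp only: cong_add_lcancel)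
  then have phi1: "\<phi> (E 0 0 1) = E a b 1" using phi1 by (simp add: E_eq_iff)
  have phi_c: "\<phi> (E 0 0 c) = E (a * gsum c) (b * int c) c" for c
    using pow[of 0 0 1 c] by (simp add: E_pow phi1 gsum_def mult.commute del: One_nat_def)
  have "E 0 0 p = E 0 0 0" by (simp add: E_eq_iff cong_0_iff)
  then have "E (a * gsum p) (b * int p) p = E 0 0 0" using phi_c[of p] one by simp
  then have pb: "q dvd int p * b" by (simp add: E_eq_iff cong_0_iff mult.commute)
  \<comment> \<open>The image of the generator of \<open>C\<^bsub>p^m\<^esub>\<close> commutes with the two images found so far.\<close>
  obtain a' v k' where phi2: "\<phi> (E 0 1 0) = E a' v k'" using ex by blast
  have "E 0 1 0 \<otimes>\<^bsub>G\<^esub> E 1 0 0 = E 1 0 0 \<otimes>\<^bsub>G\<^esub> E 0 1 0" by (simp add: E_mult)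
  then have "E a' v k' \<otimes>\<^bsub>G\<^esub> E u 0 0 = E u 0 0 \<otimes>\<^bsub>G\<^esub> E a' v k'"
    by (metis mult phi2 phi_u1)
  then have "[a' + \<omega> ^ k' * u = a' + \<omega> ^ 0 * u] (mod int n)" by (simp add: E_mult E_eq_iff ac_simps)
  then have k': "[k' = 0] (mod p)" by (intro same_power) (simp only: cong_add_lcancel)
  then have phi2: "\<phi> (E 0 1 0) = E a' v 0" using phi2 by (simp add: E_eq_iff)
  have "E 0 1 0 \<otimes>\<^bsub>G\<^esub> E 0 0 1 = E 0 0 1 \<otimes>\<^bsub>G\<^esub> E 0 1 0" by (simp add: E_mult)
  then have "E a' v 0 \<otimes>\<^bsub>G\<^esub> E a b 1 = E a b 1 \<otimes>\<^bsub>G\<^esub> E a' v 0"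
    by (metis mult phi1 phi2)
  then have "[a' + a = a + \<omega> * a'] (mod int n)" by (simp add: E_mult E_eq_iff)
  then have "int n dvd (a + \<omega> * a') - (a' + a)" by (metis cong_iff_dvd_diff cong_sym)
  then have "int n dvd (\<omega> - 1) * a'" by (simp add: algebra_simps)
  then have "int n dvd a'" using coprime_omega_minus_one by (simp add: coprime_dvd_mult_right_iff coprime_commute)
  then have phi2: "\<phi> (E 0 1 0) = E 0 v 0" using phi2 by (simp add: E_eq_iff cong_0_iff)
  have phi_v: "\<phi> (E 0 z 0) = E 0 (v * z) 0" for z
  proof -
    let ?i = "nat (z mod q)"
    have i: "int ?i = z mod q" using q_pos by simp
    have "E 0 z 0 = E 0 1 0 [^]\<^bsub>G\<^esub> ?i" unfolding E_pow E_eq_iff i by simp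
    then have "\<phi> (E 0 z 0) = E 0 v 0 [^]\<^bsub>G\<^esub> ?i" using pow phi2 by simp
    also have "\<dots> = E 0 (v * z) 0"
      unfolding E_pow E_eq_iff i by (simp add: cong_def mod_mult_left_eq mult.commute[of v])
    finally show ?thesis .
  qed
  have cv: "coprime v q"
  proof (rule coprime_if_mult_inj_mod[OF q_pos])
    fix z assume "q dvd v * z"
    then have "\<phi> (E 0 z 0) = \<phi> (E 0 0 0)" using phi_v[of z] one by (simp add: E_eq_iff cong_0_iff)
    then show "q dvd z" using inj by (metis E_eq_iff cong_0_iff)
  qed
  have "\<phi> (E x z c) = E (u * x + a * gsum c) (v * z + b * int c) c" for x z c
  proof -
    have "E x z c = E x 0 0 \<otimes>\<^bsub>G\<^esub> E 0 z 0 \<otimes>\<^bsub>G\<^esub> E 0 0 c" by (simp add: E_mult)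
    then have "\<phi> (E x z c) = \<phi> (E x 0 0) \<otimes>\<^bsub>G\<^esub> \<phi> (E 0 z 0) \<otimes>\<^bsub>G\<^esub> \<phi> (E 0 0 c)"
      using mult[of x z 0 0 0 c] mult[of x 0 0 0 z 0] by (simp add: E_mult)
    then show ?thesis by (simp add: phi_u phi_v phi_c E_mult)
  qed
  with cu cv pb show ?thesis by blast
qed

text \<open>
  The numbers \<open>u\<close>, \<open>v\<close> and \<open>b\<close> determine the Reidemeister number, so the automorphisms that move the
  generator of \<open>C\<^sub>p\<close> only by a central element \<open>b\<close> already realise the whole spectrum.
\<close>

lemma exists_automorphism:
  assumes u: "coprime u (int n)" and v: "coprime v q" and b: "q dvd int p * b"
  shows "\<exists>\<phi>\<in>auto G. \<forall>x z c. \<phi> (E x z c) = E (u * x) (v * z + b * int c) c"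
proof -
  define \<phi> where "\<phi> = (\<lambda>g\<in>carrier G. E (u * fst (fst g)) (v * snd (fst g) + b * snd g) (nat (snd g)))"
  have bc: "[b * int (c mod p) = b * int c] (mod q)" for c
  proof -
    have "int c - int (c mod p) = int p * int (c div p)" by (metis add_diff_cancel_right' mult_div_mod_eq of_nat_add of_nat_mult)
    then have "b * int c - b * int (c mod p) = (int p * b) * int (c div p)"
      by (simp flip: right_diff_distrib)
    then show ?thesis using b by (metis cong_iff_dvd_diff cong_sym dvd_mult2)
  qed
  have eq: "\<phi> (E x z c) = E (u * x) (v * z + b * int c) c" for x z c
  proof -
    have "[v * (z mod q) + b * int (c mod p) = v * z + b * int c] (mod q)"
      by (intro cong_add bc) (simp add: cong_def mod_mult_right_eq)
    then have "E (u * (x mod int n)) (v * (z mod q) + b * int (c mod p)) (c mod p) = E (u * x) (v * z + b * int c) c"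
      by (simp add: E_eq_iff) (simp add: cong_def mod_mult_right_eq)
    moreover have "\<phi> (E x z c) = E (u * (x mod int n)) (v * (z mod q) + b * int (c mod p)) (c mod p)"
      unfolding \<phi>_def restrict_apply'[OF E_closed] by (simp add: E_def)
    ultimately show ?thesis by simp
  qed
  have hom: "\<phi> \<in> hom G G"
  proof (rule homI)
    fix g h assume "g \<in> carrier G" "h \<in> carrier G"
    then show "\<phi> (g \<otimes>\<^bsub>G\<^esub> h) = \<phi> g \<otimes>\<^bsub>G\<^esub> \<phi> h"
      by (elim carrier_E) (simp add: eq E_mult algebra_simps)
  qed (auto simp: eq elim!: carrier_E)
  have "inj_on \<phi> (carrier G)"
  proof (rule inj_onI)
    fix g h assume "g \<in> carrier G" "h \<in> carrier G" and gh: "\<phi> g = \<phi> h"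
    then obtain x z c x' z' c' where g: "g = E x z c" and h: "h = E x' z' c'" and "c < p" "c' < p"
      by (metis carrier_E)
    from gh have 1: "[u * x = u * x'] (mod int n)" "[v * z + b * int c = v * z' + b * int c'] (mod q)" "[c = c'] (mod p)"
      by (simp_all add: g h eq E_eq_iff)
    then have "c = c'" using \<open>c < p\<close> \<open>c' < p\<close> by (simp add: cong_def)
    then have "[v * z = v * z'] (mod q)" using 1(2) by (simp only: cong_add_rcancel)
    then show "g = h" using 1 u v \<open>c = c'\<close> by (simp add: g h E_eq_iff cong_mult_lcancel)
  qed
  moreover have "finite (carrier G)" by (simp add: carrier_G)
  moreover have "\<phi> ` carrier G \<subseteq> carrier G" using hom by (auto simp: hom_def)
  ultimately have "bij_betw \<phi> (carrier G) (carrier G)"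
    by (simp add: bij_betw_def endo_inj_surj)
  then have "\<phi> \<in> auto G" using hom by (simp add: auto_def Bij_def \<phi>_def)
  then show ?thesis using eq by blast
qed

text \<open>
  Twisted conjugation by \<open>E y w k\<close> preserves the coset \<open>c\<close>. There \<open>y\<close> and \<open>w\<close> translate by the multiples of
  \<open>1 - \<omega> ^ c * u\<close> and \<open>1 - v\<close>, while \<open>k\<close> acts on the first coordinate by an affine map with
  linear part \<open>\<omega> ^ k\<close>. Since \<open>\<omega> - 1\<close> is invertible modulo \<open>n\<close>, these affine maps share the fixed point
  \<open>\<omega> ^ c * \<eta>\<close>, and measured from it they are linear.
\<close>

lemma twisted_conj_E_iff:
  assumes phi: "\<phi> \<in> auto G"
    and eq: "\<And>x z c. \<phi> (E x z c) = E (u * x + a * gsum c) (v * z + b * int c) c"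
    and \<eta>: "[(\<omega> - 1) * \<eta> = a] (mod int n)"
  shows "(E x z c, E x' z' c') \<in> twisted_conj G \<phi> \<longleftrightarrow>
    [c = c'] (mod p) \<and>
    (\<exists>k. [x - \<omega> ^ c * \<eta> = \<omega> ^ k * (x' - \<omega> ^ c * \<eta>)] (mod int (fix_count u c)) \<and>
         [z = z' - b * int k] (mod gcd (1 - v) q))"
proof -
  have agsum: "[a * gsum k = \<eta> * (\<omega> ^ k - 1)] (mod int n)" for k
    using cong_scalar_right[OF \<eta>, of "gsum k"] gsum_mult[of k] by (simp add: cong_sym_eq ac_simps)
  have step: "E x z c = E y w k \<otimes>\<^bsub>G\<^esub> E x' z' c' \<otimes>\<^bsub>G\<^esub> inv\<^bsub>G\<^esub> (\<phi> (E y w k)) \<longleftrightarrow>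
    [c = c'] (mod p) \<and>
    [x - \<omega> ^ c * \<eta> = \<omega> ^ k * (x' - \<omega> ^ c * \<eta>) + (1 - \<omega> ^ c * u) * y] (mod int n) \<and>
    [z = z' - b * int k + (1 - v) * w] (mod q)" for y w k
  proof -
    have "E x z c = E y w k \<otimes>\<^bsub>G\<^esub> E x' z' c' \<otimes>\<^bsub>G\<^esub> inv\<^bsub>G\<^esub> (\<phi> (E y w k)) \<longleftrightarrow>
        E x z c \<otimes>\<^bsub>G\<^esub> \<phi> (E y w k) = E y w k \<otimes>\<^bsub>G\<^esub> E x' z' c'"
      by (metis E_closed E_mult G.inv_solve_right eq)
    also have "\<dots> \<longleftrightarrow> [x + \<omega> ^ c * (u * y + a * gsum k) = y + \<omega> ^ k * x'] (mod int n) \<and>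
        [z + (v * w + b * int k) = w + z'] (mod q) \<and> [c + k = k + c'] (mod p)"
      by (simp add: eq E_mult E_eq_iff)
    also have "[c + k = k + c'] (mod p) \<longleftrightarrow> [c = c'] (mod p)"
      by (metis add.commute cong_add_rcancel_nat)
    also have "[z + (v * w + b * int k) = w + z'] (mod q) \<longleftrightarrow> [z = z' - b * int k + (1 - v) * w] (mod q)"
      by (simp add: cong_iff_dvd_diff algebra_simps)
    also have "[x + \<omega> ^ c * (u * y + a * gsum k) = y + \<omega> ^ k * x'] (mod int n) \<longleftrightarrow>
        [x + \<omega> ^ c * (u * y + \<eta> * (\<omega> ^ k - 1)) = y + \<omega> ^ k * x'] (mod int n)"
    proof -
      have "[x + \<omega> ^ c * (u * y + a * gsum k) = x + \<omega> ^ c * (u * y + \<eta> * (\<omega> ^ k - 1))] (mod int n)"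
        by (intro cong_add cong_scalar_left agsum cong_refl)
      then show ?thesis by (meson cong_sym cong_trans)
    qed
    also have "\<dots> \<longleftrightarrow> [x - \<omega> ^ c * \<eta> = \<omega> ^ k * (x' - \<omega> ^ c * \<eta>) + (1 - \<omega> ^ c * u) * y] (mod int n)"
      by (simp add: cong_iff_dvd_diff algebra_simps)
    finally show ?thesis by blast
  qed
  have "(E x z c, E x' z' c') \<in> twisted_conj G \<phi> \<longleftrightarrow>
    (\<exists>y w k. E x z c = E y w k \<otimes>\<^bsub>G\<^esub> E x' z' c' \<otimes>\<^bsub>G\<^esub> inv\<^bsub>G\<^esub> (\<phi> (E y w k)))"
    unfolding twisted_conj_def by (auto elim!: carrier_E) blast
  also have "\<dots> \<longleftrightarrow> [c = c'] (mod p) \<and> (\<exists>k.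
    (\<exists>y. [x - \<omega> ^ c * \<eta> = \<omega> ^ k * (x' - \<omega> ^ c * \<eta>) + (1 - \<omega> ^ c * u) * y] (mod int n)) \<and>
    (\<exists>w. [z = z' - b * int k + (1 - v) * w] (mod q)))"
    unfolding step by blast
  finally show ?thesis unfolding exists_cong_add_mult_iff int_fix_count .
qed

text \<open>
  The twisted classes are the \<open>C\<^sub>p\<close>-orbits on the reduced set: \<open>\<rho>\<close> moves the common fixed point of each
  coset to \<open>0\<close> and reduces the coordinates.
\<close>

lemma reidemeister_number_eq:
  assumes phi: "\<phi> \<in> auto G"
    and eq: "\<And>x z c. \<phi> (E x z c) = E (u * x + a * gsum c) (v * z + b * int c) c"
    and b: "q dvd int p * b" and P: "int P = gcd (1 - v) q"
  shows "\<exists>N. reidemeister_number G \<phi> = enat N \<and> real N =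
    (if int P dvd b
     then real P * (real p + (real (sum_list (fix_counts u)) - real p) / real p)
     else real P * real (sum_list (fix_counts u)) / real p)"
proof -
  let ?D = "fix_count u"
  let ?S = "reduced_set p ?D P" and ?s = "reduced_rel \<omega> b p ?D P"
  obtain i where i: "[(\<omega> - 1) * i = 1] (mod int n)"
    using cong_solve_coprime_int[OF coprime_omega_minus_one] by blast
  define \<eta> where "\<eta> = i * a"
  have \<eta>: "[(\<omega> - 1) * \<eta> = a] (mod int n)"
    using cong_scalar_right[OF i, of a] by (simp add: \<eta>_def mult.assoc)
  have Pq: "int P dvd q" using P by simp
  then have Pp: "P dvd p ^ m" by (simp only: int_dvd_int_iff)
  have P0: "P > 0" using P q_pos by (metis gcd_pos_int of_nat_0_less_iff order_less_irrefl)
  have Pb: "int P dvd int p * b" using Pq b by (rule dvd_trans)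
  have Dn: "\<And>c. c < p \<Longrightarrow> ?D c dvd n" by (rule fix_count_dvd)
  define \<rho> where "\<rho> = (\<lambda>g. let c = nat (snd g) in
      (c, (fst (fst g) - \<omega> ^ c * \<eta>) mod int (?D c), snd (fst g) mod int P))"
  have rho: "\<rho> (E x z c) = (c, (x - \<omega> ^ c * \<eta>) mod int (?D c), z mod int P)" if "c < p" for x z c
  proof -
    have "[x mod int n - \<omega> ^ c * \<eta> = x - \<omega> ^ c * \<eta>] (mod int (?D c))"
      using fix_count_dvd[of u c] by (intro cong_diff) (simp_all add: cong_def mod_mod_cancel)
    then show ?thesis using that Pq by (simp add: \<rho>_def E_def cong_def mod_mod_cancel)
  qed
  have image: "\<rho> ` carrier G = ?S"
  proof (intro subset_antisym subsetI)
    fix y assume "y \<in> \<rho> ` carrier G"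
    then obtain x z c where "c < p" "y = \<rho> (E x z c)" by (auto elim!: carrier_E)
    then show "y \<in> ?S" using rho P0 fix_count_pos[of u c] by (simp add: reduced_set_def)
  next
    fix y assume "y \<in> ?S"
    then obtain c X Z where y: "y = (c, X, Z)" "c < p" "0 \<le> X" "X < int (?D c)" "0 \<le> Z" "Z < int P"
      by (auto simp: reduced_set_def)
    then have "y = \<rho> (E (X + \<omega> ^ c * \<eta>) Z c)" by (simp add: rho)
    then show "y \<in> \<rho> ` carrier G" by simp
  qed
  have "card (carrier G // twisted_conj G \<phi>) = card (?S // ?s)"
  proof (rule card_quotient_reduction[OF image])
    show "twisted_conj G \<phi> \<subseteq> carrier G \<times> carrier G" by (auto simp: twisted_conj_def)
    show "?s \<subseteq> ?S \<times> ?S" by (auto simp: reduced_rel_def)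
    fix g h assume gh: "g \<in> carrier G" "h \<in> carrier G"
    obtain x z c where g: "g = E x z c" "c < p" using gh(1) by (rule carrier_E)
    obtain x' z' c' where h: "h = E x' z' c'" "c' < p" using gh(2) by (rule carrier_E)
    have m: "\<rho> g \<in> ?S" "\<rho> h \<in> ?S" using gh image by auto
    have cc: "[c = c'] (mod p) \<longleftrightarrow> c = c'" using g h by (simp add: cong_def)
    have "(\<rho> g, \<rho> h) \<in> ?s \<longleftrightarrow> c = c' \<and>
      (\<exists>k. [x - \<omega> ^ c * \<eta> = \<omega> ^ k * (x' - \<omega> ^ c' * \<eta>)] (mod int (?D c)) \<and>
         [z = z' - b * int k] (mod int P))"
      using m unfolding g(1) h(1) rho[OF g(2)] rho[OF h(2)] reduced_rel_def
      by (auto simp: cong_def mod_mult_right_eq mod_diff_left_eq)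
    then show "(g, h) \<in> twisted_conj G \<phi> \<longleftrightarrow> (\<rho> g, \<rho> h) \<in> ?s"
      unfolding g(1) h(1) twisted_conj_E_iff[OF phi eq \<eta>] cc P by auto
  qed
  moreover have "finite (carrier G // twisted_conj G \<phi>)"
    by (rule finite_quotient) (auto simp: carrier_G twisted_conj_def)
  ultimately show ?thesis
    using card_reduced_quotient[OF Dn P0 Pb Pp]
    by (simp add: reidemeister_number_def sum_list_fix_counts)
qed

end

section \<open>The spectrum\<close>

context smc_coordinates
begin

text \<open>
  The two possible Reidemeister numbers, according to whether the translation part of the \<open>C\<^sub>p\<close>-action on the
  reduced set is trivial or free.
\<close>

abbreviation (input) "nonfree_value e d \<equiv>
  real p ^ (e + 1) + real p powi (int e - 1) * (real (sum_list d) - real p)"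

abbreviation (input) "free_value d \<equiv>
  real p ^ m + real p ^ (m - 1) * (real (sum_list d) - real p)"

lemma nonfree_value_eq:
  "real (p ^ e) * (real p + (real (sum_list d) - real p) / real p) = nonfree_value e d"
proof -
  have "real p powi (int e - 1) = real p ^ e / real p"
    using p_pos by (simp add: power_int_diff)
  then show ?thesis by (simp add: algebra_simps)
qed

lemma free_value_eq:
  assumes "m \<ge> 1"
  shows "real (p ^ m) * real (sum_list d) / real p = free_value d"
proof -
  obtain k where "m = Suc k" using assms by (cases m) auto
  then show ?thesis using p_pos by (simp add: algebra_simps)
qed

text \<open>
  Since \<open>p * b\<close> vanishes modulo \<open>p ^ m\<close>, the translation by \<open>b\<close> can be nontrivial modulo \<open>p ^ e\<close> only
  for \<open>e = m \<ge> 1\<close>.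
\<close>

lemma reidemeister_number_cases:
  assumes phi: "\<phi> \<in> auto G"
    and eq: "\<And>x z c. \<phi> (E x z c) = E (u * x + a * gsum c) (v * z + b * int c) c"
    and b: "q dvd int p * b" and e: "gcd (1 - v) q = int (p ^ e)" and "e \<le> m"
  shows "ereal_of_enat (reidemeister_number G \<phi>) =
    ereal (if int (p ^ e) dvd b then nonfree_value e (fix_counts u) else free_value (fix_counts u))"
    and "\<not> int (p ^ e) dvd b \<Longrightarrow> e = m \<and> m \<ge> 1"
proof -
  show em: "e = m \<and> m \<ge> 1" if nd: "\<not> int (p ^ e) dvd b"
  proof -
    have m: "m \<ge> 1" using nd \<open>e \<le> m\<close> by (cases "m = 0") auto
    then have "int p ^ m = int p * int p ^ (m - 1)" by (simp add: power_eq_if)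
    then have "int p * int p ^ (m - 1) dvd int p * b" using b by simp
    then have "int p ^ (m - 1) dvd b" using p_pos by simp
    then have "\<not> e \<le> m - 1" using nd by (metis dvd_trans le_imp_power_dvd of_nat_power)
    then show ?thesis using m \<open>e \<le> m\<close> by simp
  qed
  obtain N where N: "reidemeister_number G \<phi> = enat N" and val: "real N =
    (if int (p ^ e) dvd b
     then real (p ^ e) * (real p + (real (sum_list (fix_counts u)) - real p) / real p)
     else real (p ^ e) * real (sum_list (fix_counts u)) / real p)"
    using reidemeister_number_eq[OF phi eq b, of "p ^ e"] e by auto
  have "real N = (if int (p ^ e) dvd b then nonfree_value e (fix_counts u) else free_value (fix_counts u))"
  proof (cases "int (p ^ e) dvd b")
    case True
    then show ?thesis using val by (simp only: nonfree_value_eq if_True)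
  next
    case False
    then have "e = m" "m \<ge> 1" using em by auto
    then show ?thesis using val False by (simp only: free_value_eq if_False)
  qed
  then show "ereal_of_enat (reidemeister_number G \<phi>) =
    ereal (if int (p ^ e) dvd b then nonfree_value e (fix_counts u) else free_value (fix_counts u))"
    using N by simp
qed

text \<open>
  The unit \<open>v = 1 + p ^ e\<close> realises the exponent \<open>e\<close>. It fails to be a unit only for \<open>e = 0\<close>, \<open>p = 2\<close>,
  \<open>m \<ge> 1\<close>, and this exponent is impossible because \<open>1 - v\<close> is even for every unit \<open>v\<close> modulo \<open>2 ^ m\<close>. The second
  family comes from \<open>e = m\<close> and \<open>b = p ^ (m - 1)\<close>.
\<close>

lemma spectrum_eq:
  "ereal_of_enat ` reidemeister_spectrum G =
     {ereal (nonfree_value e d) | e d.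
        e \<le> m \<and> (p = 2 \<and> m \<ge> 1 \<longrightarrow> e \<ge> 1) \<and> d \<in> fix_counts ` {u. coprime u (int n)}} \<union>
     {ereal (free_value d) | d. m \<ge> 1 \<and> d \<in> fix_counts ` {u. coprime u (int n)}}"
  (is "?L = ?A \<union> ?B")
proof (intro subset_antisym subsetI)
  fix r assume "r \<in> ?L"
  then obtain \<phi> where phi: "\<phi> \<in> auto G" and r: "r = ereal_of_enat (reidemeister_number G \<phi>)"
    by (auto simp: reidemeister_spectrum_def)
  obtain u v a b where u: "coprime u (int n)" and v: "coprime v q" and b: "q dvd int p * b"
    and eq: "\<And>x z c. \<phi> (E x z c) = E (u * x + a * gsum c) (v * z + b * int c) c"
    using automorphism_form[OF phi] by blast
  have g: "int (nat (gcd (1 - v) q)) = gcd (1 - v) q" by simp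
  then have "nat (gcd (1 - v) q) dvd p ^ m" by (metis gcd_dvd2 int_dvd_int_iff)
  then obtain e where e: "e \<le> m" "nat (gcd (1 - v) q) = p ^ e"
    using divides_primepow_nat[OF prime_p] by blast
  then have e': "gcd (1 - v) q = int (p ^ e)" using g by simp
  note R = reidemeister_number_cases[OF phi eq b e' e(1)]
  show "r \<in> ?A \<union> ?B"
  proof (cases "int (p ^ e) dvd b")
    case True
    have "e \<ge> 1" if "p = 2" "m \<ge> 1"
    proof -
      have "(2::int) dvd q" using that by simp
      moreover from this have "\<not> 2 dvd v" using v coprime_common_divisor[of v q 2] by auto
      then have "2 dvd 1 - v" by simp
      ultimately have "2 dvd int (p ^ e)" unfolding e'[symmetric] by simp
      then show ?thesis by (cases e) auto
    qed
    then have "r \<in> ?A" using R(1) r u e(1) True by auto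
    then show ?thesis ..
  next
    case False
    then have "r \<in> ?B" using R r u by auto
    then show ?thesis ..
  qed
next
  fix r assume "r \<in> ?A \<union> ?B"
  then obtain e u b where u: "coprime u (int n)" and e: "e \<le> m" "p = 2 \<and> m \<ge> 1 \<longrightarrow> e \<ge> 1"
    and b: "q dvd int p * b"
    and r: "r = ereal (if int (p ^ e) dvd b then nonfree_value e (fix_counts u)
                       else free_value (fix_counts u))"
  proof
    assume "r \<in> ?A"
    then show thesis using that[where b = 0] by auto
  next
    assume "r \<in> ?B"
    then obtain u where u: "coprime u (int n)" "m \<ge> 1" "r = ereal (free_value (fix_counts u))" by blast
    have "\<not> int (p ^ m) dvd int (p ^ (m - 1))"
      unfolding int_dvd_int_iff using u(2) p_ge_2 by (auto dest!: power_dvd_imp_le)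
    moreover have "q dvd int p * int (p ^ (m - 1))"
      using u(2) by (simp add: power_eq_if)
    ultimately show thesis using that[of u m "int (p ^ (m - 1))"] u by simp
  qed
  let ?v = "1 + int p ^ e"
  have v: "coprime ?v q"
  proof (cases "m = 0")
    case False
    have "coprime ?v (int p)"
    proof (cases "e = 0")
      case True
      then have "p \<noteq> 2" using e(2) False by auto
      then have "odd p" using prime_p primes_dvd_imp_eq two_is_prime_nat by blast
      then have "coprime 2 (int p)" by simp
      then show ?thesis using True by simp
    next
      case False
      have "[1 = ?v] (mod int p)" using False by (simp add: cong_iff_dvd_diff)
      then show ?thesis using cong_imp_coprime coprime_1_left by blast
    qed
    then show ?thesis by simp
  qed simp
  have g: "gcd (1 - ?v) q = int (p ^ e)"
    using e(1) by (simp add: gcd_proj1_iff le_imp_power_dvd)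
  obtain \<phi> where phi: "\<phi> \<in> auto G"
    and eq: "\<And>x z c. \<phi> (E x z c) = E (u * x + 0 * gsum c) (?v * z + b * int c) c"
    using exists_automorphism[OF u v b] by auto
  have "r = ereal_of_enat (reidemeister_number G \<phi>)"
    using reidemeister_number_cases(1)[OF phi eq b g e(1)] r by simp
  then show "r \<in> ?L" using phi by (auto simp: reidemeister_spectrum_def)
qed

end

text \<open>
  Each \<open>\<alpha> c\<close> maps \<open>C\<^sub>n\<close> into itself by coprimality of \<open>n\<close> and \<open>p\<close>, hence acts there as a multiplication; the
  multiplier of the generator is \<open>\<omega>\<close>. Freeness of the action is injectivity of \<open>\<omega> - 1\<close> on \<open>C\<^sub>n\<close>.
\<close>

lemma exists_smc_coordinates:
  assumes n: "n \<ge> 2" and p: "prime p" and np: "gcd n p = 1"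
    and action: "SMC_action n m p \<alpha>"
    and trivial: "\<forall>c\<in>carrier (integer_mod_group p). \<forall>y\<in>carrier (integer_mod_group (p ^ m)).
           \<alpha> c (0, y) = (0, y)"
  shows "\<exists>\<omega>. smc_coordinates n p \<omega> m \<alpha>"
proof -
  let ?q = "int (p ^ m)"
  let ?B = "SMC_base n m p"
  have p0: "p > 0" using p prime_gt_0_nat by blast
  have p2: "p \<ge> 2" using p prime_ge_2_nat by blast
  have q0: "?q > 0" using p0 by simp
  have n0: "int n > 0" using n by simp
  have carrB: "carrier ?B = {0..<int n} \<times> {0..<?q}" and carrP: "carrier (integer_mod_group p) = {0..<int p}"
    using n p0 by (simp_all add: DirProd_def carrier_integer_mod_group)
  have multB: "(x, z) \<otimes>\<^bsub>?B\<^esub> (x', z') = ((x + x') mod int n, (z + z') mod ?q)" for x z x' z'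
    by (simp add: DirProd_def)
  have oneB: "\<one>\<^bsub>?B\<^esub> = (0, 0)" by (simp add: DirProd_def)
  have hom\<alpha>: "\<alpha> \<in> hom (integer_mod_group p) (AutoGroup ?B)"
    and free: "\<And>x. x \<in> {0..<int n} \<Longrightarrow> (\<forall>c\<in>{0..<int p}. \<alpha> c (x, 0) = (x, 0)) \<Longrightarrow> x = 0"
    using action n p0 by (simp_all add: SMC_action_def carrier_integer_mod_group)
  have auto\<alpha>: "\<alpha> c \<in> auto ?B" if "c \<in> {0..<int p}" for c
    using hom\<alpha> that carrP by (auto simp: hom_def AutoGroup_def BijGroup_def)
  have groupB: "group ?B" by (simp add: DirProd_group)
  have hom: "\<alpha> c \<in> hom ?B ?B" if "c \<in> {0..<int p}" for c
    using auto\<alpha>[OF that] by (simp add: auto_def)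
  have comp: "\<alpha> ((c + d) mod int p) x = \<alpha> c (\<alpha> d x)"
    if "c \<in> {0..<int p}" "d \<in> {0..<int p}" "x \<in> carrier ?B" for c d x
  proof -
    have "\<alpha> ((c + d) mod int p) = \<alpha> c \<otimes>\<^bsub>AutoGroup ?B\<^esub> \<alpha> d"
      using hom_mult[OF hom\<alpha>, of c d] that carrP by simp
    also have "\<dots> = compose (carrier ?B) (\<alpha> c) (\<alpha> d)"
      using auto\<alpha>[OF that(1)] auto\<alpha>[OF that(2)] by (simp add: AutoGroup_def BijGroup_def auto_def)
    finally show ?thesis using that(3) by (simp add: compose_eq)
  qed
  have linear: "\<exists>w. \<forall>x\<in>{0..<int n}. \<forall>z\<in>{0..<?q}. \<alpha> c (x, z) = (w * x mod int n, z)"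
    if c: "c \<in> {0..<int p}" for c
  proof -
    obtain w t where wt: "\<alpha> c (1, 0) = (w, t)" by (metis surj_pair)
    have mult: "\<alpha> c ((x, z) \<otimes>\<^bsub>?B\<^esub> (x', z')) = \<alpha> c (x, z) \<otimes>\<^bsub>?B\<^esub> \<alpha> c (x', z')"
      if "x \<in> {0..<int n}" "z \<in> {0..<?q}" "x' \<in> {0..<int n}" "z' \<in> {0..<?q}" for x z x' z'
      by (rule hom_mult[OF hom[OF c]]) (use that carrB in auto)
    have one: "\<alpha> c (0, 0) = (0, 0)" using hom_one[OF hom[OF c] groupB groupB] oneB by simp
    have pow: "\<alpha> c (int i mod int n, 0) = (w * int i mod int n, t * int i mod ?q)" for i
    proof (induction i)
      case (Suc i)
      have "\<alpha> c (int (Suc i) mod int n, 0) = \<alpha> c ((int i mod int n, 0) \<otimes>\<^bsub>?B\<^esub> (1, 0))"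
        by (simp add: multB mod_simps add.commute)
      also have "\<dots> = \<alpha> c (int i mod int n, 0) \<otimes>\<^bsub>?B\<^esub> \<alpha> c (1, 0)"
        using n q0 by (intro mult) auto
      finally show ?case using Suc wt by (simp add: multB mod_simps algebra_simps)
    qed (use one in simp)
    have "t * int n mod ?q = 0" using pow[of n] one by simp
    then have "?q dvd t * int n" by (simp add: dvd_eq_mod_eq_0)
    moreover have "coprime n p" using np by (simp only: coprime_iff_gcd_eq_1)
    then have "coprime ?q (int n)" by (simp add: coprime_commute)
    ultimately have t: "?q dvd t" by (simp add: coprime_dvd_mult_left_iff)
    have "\<alpha> c (x, z) = (w * x mod int n, z)" if "x \<in> {0..<int n}" "z \<in> {0..<?q}" for x z
    proof -
      have "(x, z) = (x, 0) \<otimes>\<^bsub>?B\<^esub> (0, z)" using that by (simp add: multB)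
      then have "\<alpha> c (x, z) = \<alpha> c (x, 0) \<otimes>\<^bsub>?B\<^esub> \<alpha> c (0, z)" using mult[of x 0 0 z] that n0 q0 by simp
      also have "\<alpha> c (x, 0) = (w * x mod int n, 0)"
        using pow[of "nat x"] that t by simp
      also have "\<alpha> c (0, z) = (0, z)" using trivial c that carrP p0 by (simp add: carrier_integer_mod_group)
      finally show ?thesis using that by (simp add: multB)
    qed
    then show ?thesis by blast
  qed
  have one_in: "1 \<in> {0..<int p}" using p2 by simp
  obtain \<omega> where \<omega>: "\<And>x z. x \<in> {0..<int n} \<Longrightarrow> z \<in> {0..<?q} \<Longrightarrow> \<alpha> 1 (x, z) = (\<omega> * x mod int n, z)"
    using linear[OF one_in] by blast
  have "group (integer_mod_group p)" by simp
  moreover have "group (AutoGroup ?B)" using groupB by (simp add: group.AutoGroup)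
  ultimately have "\<alpha> 0 = \<one>\<^bsub>AutoGroup ?B\<^esub>" using hom_one[OF hom\<alpha>] by simp
  then have \<alpha>0: "\<alpha> 0 x = x" if "x \<in> carrier ?B" for x
    using that by (simp add: AutoGroup_def BijGroup_def)
  have Suc\<alpha>: "\<alpha> ((c + 1) mod int p) (x, z) = \<alpha> c (\<omega> * x mod int n, z)"
    if "c \<in> {0..<int p}" "x \<in> {0..<int n}" "z \<in> {0..<?q}" for c x z
  proof -
    have "(x, z) \<in> carrier ?B" unfolding carrB using that by simp
    then show ?thesis by (simp only: comp[OF that(1) one_in] \<omega>[OF that(2,3)])
  qed
  have action_eq: "\<alpha> (int c) (x, z) = (\<omega> ^ c * x mod int n, z)"
    if "c < p" "x \<in> {0..<int n}" "z \<in> {0..<?q}" for c x z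
    using that
  proof (induction c arbitrary: x)
    case 0
    then have "(x, z) \<in> carrier ?B" unfolding carrB by simp
    from \<alpha>0[OF this] 0 show ?case by simp
  next
    case (Suc c)
    have "\<alpha> (int (Suc c)) (x, z) = \<alpha> (int c) (\<omega> * x mod int n, z)"
      using Suc\<alpha>[of "int c" x z] Suc.prems by (simp add: add.commute)
    also have "\<dots> = (\<omega> ^ c * (\<omega> * x mod int n) mod int n, z)"
      using Suc.prems n0 by (intro Suc.IH) auto
    finally show ?case by (simp add: mod_mult_right_eq mult.assoc mult.left_commute)
  qed
  have "\<alpha> ((int (p - 1) + 1) mod int p) (1, 0) = \<alpha> (int (p - 1)) (\<omega> * 1 mod int n, 0)"
    using p0 n q0 by (intro Suc\<alpha>) auto
  also have "(int (p - 1) + 1) mod int p = 0" using p0 by (simp add: of_nat_diff)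
  also have "\<alpha> 0 (1, 0) = (1, 0)" using n q0 by (intro \<alpha>0) (simp add: carrB)
  also have "\<alpha> (int (p - 1)) (\<omega> * 1 mod int n, 0) = (\<omega> ^ (p - 1) * (\<omega> * 1 mod int n) mod int n, 0)"
    using p0 n0 q0 by (intro action_eq) auto
  finally have "\<omega> ^ (p - 1) * \<omega> mod int n = 1" by (simp add: mod_mult_right_eq)
  moreover have "\<omega> ^ (p - 1) * \<omega> = \<omega> ^ p" using p0 by (metis power_minus_mult)
  ultimately have wp: "[\<omega> ^ p = 1] (mod int n)" using n by (simp add: cong_def)
  have w1: "coprime (\<omega> - 1) (int n)"
  proof (rule coprime_if_mult_inj_mod[OF n0])
    fix x assume "int n dvd (\<omega> - 1) * x"
    then have fx: "[\<omega> * x = x] (mod int n)" by (simp add: cong_iff_dvd_diff algebra_simps)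
    have fix_pow: "[\<omega> ^ c * x = x] (mod int n)" for c
    proof (induction c)
      case (Suc c)
      have "[\<omega> * (\<omega> ^ c * x) = \<omega> * x] (mod int n)" using Suc by (rule cong_scalar_left)
      then show ?case using fx cong_trans by (simp add: mult.assoc) blast
    qed simp
    have "\<alpha> c (x mod int n, 0) = (x mod int n, 0)" if c: "c \<in> {0..<int p}" for c
    proof -
      have "\<alpha> (int (nat c)) (x mod int n, 0) = (\<omega> ^ nat c * (x mod int n) mod int n, 0)"
        using c n0 q0 by (intro action_eq) auto
      also have "\<omega> ^ nat c * (x mod int n) mod int n = x mod int n"
        using fix_pow[of "nat c"] by (simp add: cong_def mod_mult_right_eq)
      finally show ?thesis using c by simp
    qed
    then have "x mod int n = 0" using n0 by (intro free) auto
    then show "int n dvd x" by (simp add: dvd_eq_mod_eq_0)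
  qed
  have "smc_coordinates n p \<omega> m \<alpha>"
    using n p wp w1 np action_eq by unfold_locales (auto simp: coprime_iff_gcd_eq_1)
  then show ?thesis ..
qed

theorem theorem4p1p3:
  fixes n m p :: nat and \<alpha> :: "int \<Rightarrow> int \<times> int \<Rightarrow> int \<times> int"
  assumes "n \<ge> 2" and "prime p" and "gcd n p = 1"
    and "SMC_action n m p \<alpha>"
    and "\<forall>c\<in>carrier (integer_mod_group p). \<forall>y\<in>carrier (integer_mod_group (p ^ m)).
           \<alpha> c (0, y) = (0, y)"
  shows
    "(odd p \<and> m = 0 \<longrightarrow>
        ereal_of_enat ` reidemeister_spectrum (SMC_group n m p \<alpha>) =
          {ereal (real p + real (sum_list d) / real p - 1) | d. d \<in> coprime_divisor_tuples n p}) \<and>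
     (odd p \<and> m \<ge> 1 \<longrightarrow>
        ereal_of_enat ` reidemeister_spectrum (SMC_group n m p \<alpha>) =
          {ereal (real p ^ (e + 1) + real p powi (int e - 1) * (real (sum_list d) - real p)) | e d.
             0 \<le> e \<and> e \<le> m \<and> d \<in> coprime_divisor_tuples n p} \<union>
          {ereal (real p ^ m + real p ^ (m - 1) * (real (sum_list d) - real p)) | d.
             d \<in> coprime_divisor_tuples n p}) \<and>
     (p = 2 \<and> m = 0 \<and> n mod 3 \<noteq> 0 \<longrightarrow>
        ereal_of_enat ` reidemeister_spectrum (SMC_group n m p \<alpha>) =
          {ereal (2 + real (sum_list d) / 2 - 1) | d. d \<in> coprime_divisor_tuples n 2}) \<and>
     (p = 2 \<and> m \<ge> 1 \<and> n mod 3 \<noteq> 0 \<longrightarrow>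
        ereal_of_enat ` reidemeister_spectrum (SMC_group n m p \<alpha>) =
          {ereal (2 ^ (e + 1) + 2 powi (int e - 1) * (real (sum_list d) - 2)) | e d.
             1 \<le> e \<and> e \<le> m \<and> d \<in> coprime_divisor_tuples n 2} \<union>
          {ereal (2 ^ m + 2 ^ (m - 1) * (real (sum_list d) - 2)) | d.
             d \<in> coprime_divisor_tuples n 2}) \<and>
     (p = 2 \<and> n mod 3 = 0 \<longrightarrow>
        (m = 0 \<longrightarrow>
          ereal_of_enat ` reidemeister_spectrum (SMC_group n m p \<alpha>) =
            {ereal (2 + real (sum_list d) / 2 - 1) | d. d \<in> coprime_divisor_tuples3 n 2}) \<and>
        (m \<ge> 1 \<longrightarrow>
          ereal_of_enat ` reidemeister_spectrum (SMC_group n m p \<alpha>) =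
            {ereal (2 ^ (e + 1) + 2 powi (int e - 1) * (real (sum_list d) - 2)) | e d.
               1 \<le> e \<and> e \<le> m \<and> d \<in> coprime_divisor_tuples3 n 2} \<union>
            {ereal (2 ^ m + 2 ^ (m - 1) * (real (sum_list d) - 2)) | d.
               d \<in> coprime_divisor_tuples3 n 2}))"
proof -
  obtain \<omega> where "smc_coordinates n p \<omega> m \<alpha>"
    using exists_smc_coordinates[OF assms] by blast
  then interpret smc_coordinates n p \<omega> m \<alpha> .
  let ?T = "if p = 2 \<and> n mod 3 = 0 then coprime_divisor_tuples3 n p else coprime_divisor_tuples n p"
  let ?R = "ereal_of_enat ` reidemeister_spectrum (SMC_group n m p \<alpha>)"
  note spectrum = spectrum_eq[unfolded fix_counts_range]
  have m_zero: "?R = {ereal (real p + real (sum_list d) / real p - 1) | d. d \<in> ?T}" if "m = 0"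
  proof -
    have "nonfree_value 0 d = real p + real (sum_list d) / real p - 1" for d
      using p_pos by (simp add: diff_divide_distrib divide_inverse[symmetric] power_int_minus
          inverse_eq_divide)
    then show ?thesis unfolding spectrum using that by (simp add: add_diff_eq)
  qed
  show ?thesis
  proof (cases "p = 2")
    case False
    then have "odd p" using prime_p by (metis primes_dvd_imp_eq two_is_prime_nat)
    with False show ?thesis using m_zero spectrum by auto
  next
    case True
    then show ?thesis using m_zero spectrum by auto
  qed
qed

end
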